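(* Let $\alpha\in\mathbb Z^2\setminus I(\mathcal A)$. The $\mathcal A$-hypergeometric functions $\psi_1(\alpha),\dots,\psi_d(\alpha)$ on $\mathcal U$ span a complex vector space of dimension at least $d-1$. Moreover, they are linearly dependent if and only if $\Psi^{\mathcal A}(\alpha):=\psi_1(\alpha)+\cdots+\psi_d(\alpha)=0$.
   Context: Setting: $m\ge 1$ and $0<k_1<\dots<k_m<d$ are integers with $\gcd(k_1,\dots,k_m,d)=1$; $\Lambda=\{0,k_1,\dots,k_m,d\}$, and all $(m+2)$-tuples are indexed by $\Lambda$. $\mathbb N=\{0,1,2,\dots\}$. $\mathcal A$ is the $2\times(m+2)$ integer matrix whose columns are $(1,j)^T$, $j\in\Lambda$. Variables $x=(x_j)_{j\in\Lambda}\in\mathbb C^{m+2}$; for $u\in\mathbb N^{\Lambda}$, $D_u=\prod_{j}(\partial/\partial x_j)^{u_j}$. $I(\mathcal A)=\mathcal A\cdot\mathbb N^{\Lambda}\subset\mathbb Z^2$. The $\mathcal A$-hypergeometric system with exponent $\alpha=(\alpha_1,\alpha_2)$ consists of the equations $\prod_{v_j>0}(\partial/\partial x_j)^{v_j}\varphi=\prod_{v_j<0}(\partial/\partial x_j)^{-v_j}\varphi$ for all $v\in\mathbb Z^{\Lambda}$ with $\mathcal A v=0$, together with $\sum_{j}x_j\,\partial\varphi/\partial x_j=\alpha_1\varphi$ and $\sum_{j}j\,x_j\,\partial\varphi/\partial x_j=\alpha_2\varphi$. Let $f(x;t)=\sum_{j\in\Lambda}x_jt^j$, and let $\Sigma\subset\mathbb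 C^{m+2}$ be the set where $x_0=0$, or $x_d=0$, or the discriminant of $f(x;t)$ (as a polynomial in $t$) vanishes. $\mathcal U\subset\mathbb C^{m+2}\setminus\Sigma$ is a nonempty simply-connected open set, $\rho_1(x),\dots,\rho_d(x)$ are the $d$ distinct roots of $f(x;t)$, holomorphic on $\mathcal U$, with fixed holomorphic branches of $\log\rho_j$. The hypergeometric polynomial is $\Phi^{\mathcal A}(\beta;x)=\sum_{u\in\mathbb N^{\Lambda},\,\mathcal A u=\beta}\prod_j x_j^{u_j}/u_j!$ (zero if $\beta\notin I(\mathcal A)$). For a root $\rho=\rho_j$ and $\alpha\in\mathbb Z^2$ with $\alpha_1\ge0$ put $$\psi_\rho(\alpha)=\sum_{0\le i\le d\alpha_1,\ i\ne\alpha_2}\Phi^{\mathcal A}((\alpha_1,i);x)\,\frac{\rho^{\,i-\alpha_2}}{i-\alpha_2}+\Phi^{\mathcal A}(\alpha;x)\log\rho .$$ For $\alpha_1<0$ put $\psi_\rho(\alpha)=D_u(\psi_\rho(\alpha+\mathcal A u))$ for any $u\in\mathbb N^{\Lambda}$ such that the first coordinate of $\mathcal A u$ is $\ge-\alpha_1$; this does not depend on the choice of $u$. Write $\psi_j(\alpha)=\psi_{\rho_j}(\alpha)$. *)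

theory Defs
  imports
    "HOL-Analysis.Analysis"
    "HOL-Library.Function_Algebras"
    "Subresultants.Resultant_Prelim"
begin

no_notation Matrix.vec_index (infixl "$" 100)

text \<open>
  The index set \<open>\<Lambda> = {0, k_1, \<dots>, k_m, d}\<close> is represented by a finite type \<open>'n\<close> together with a
  bijection \<open>e\<close> from \<open>'n\<close> onto \<open>\<Lambda>\<close>: the coordinate \<open>x_j\<close>, \<open>j \<in> \<Lambda>\<close>, is \<open>x $ i\<close> with \<open>e i = j\<close>.
\<close>

definition Lambda_set :: "nat \<Rightarrow> (nat \<Rightarrow> nat) \<Rightarrow> nat \<Rightarrow> nat set" where
  "Lambda_set m k d = {0} \<union> k ` {1..m} \<union> {d}"

text \<open>The product \<open>\<A> v\<close>, where \<open>\<A>\<close> has the columns \<open>(1, e i)\<close>; vectors of \<open>\<int>\<^sup>2\<close> are pairs.\<close>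

definition A_mult :: "('n::finite \<Rightarrow> nat) \<Rightarrow> ('n \<Rightarrow> int) \<Rightarrow> int \<times> int" where
  "A_mult e v = (\<Sum>i\<in>UNIV. v i, \<Sum>i\<in>UNIV. int (e i) * v i)"

abbreviation A_nmult :: "('n::finite \<Rightarrow> nat) \<Rightarrow> ('n \<Rightarrow> nat) \<Rightarrow> int \<times> int" where
  "A_nmult e u \<equiv> A_mult e (\<lambda>i. int (u i))"

definition I_A :: "('n::finite \<Rightarrow> nat) \<Rightarrow> (int \<times> int) set" where
  "I_A e = range (A_nmult e)"

definition partial :: "'n::finite \<Rightarrow> (complex^'n \<Rightarrow> complex) \<Rightarrow> complex^'n \<Rightarrow> complex" where
  "partial i g x = deriv (\<lambda>t. g (x + axis i t)) 0"

text \<open>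
  The operator \<open>D_u\<close>, composed in the order of increasing exponents.  The order is immaterial for
  holomorphic functions, but \<open>partial\<close> is a total operator and needs a fixed one.
\<close>

definition D_op ::
  "('n::finite \<Rightarrow> nat) \<Rightarrow> ('n \<Rightarrow> nat) \<Rightarrow> (complex^'n \<Rightarrow> complex) \<Rightarrow> complex^'n \<Rightarrow> complex" where
  "D_op e u g = foldr (\<lambda>i h. (partial i ^^ u i) h) (sorted_key_list_of_set e UNIV) g"

text \<open>Holomorphy in several variables: the Frechet derivative exists and is complex-linear.\<close>

definition mholomorphic_on :: "(complex^'n::finite \<Rightarrow> complex) \<Rightarrow> (complex^'n) set \<Rightarrow> bool" where
  "mholomorphic_on g U \<longleftrightarrow>
     (\<forall>x\<in>U. \<exists>g'. (g has_derivative g') (at x) \<and> (\<forall>c v. g' (c *s v) = c * g' v))"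

text \<open>In the toric equations \<open>nat (v i)\<close> and \<open>nat (- v i)\<close> are the positive and negative parts of \<open>v i\<close>.\<close>

definition A_hypergeometric ::
  "('n::finite \<Rightarrow> nat) \<Rightarrow> int \<times> int \<Rightarrow> (complex^'n) set \<Rightarrow> (complex^'n \<Rightarrow> complex) \<Rightarrow> bool" where
  "A_hypergeometric e \<alpha> U \<phi> \<longleftrightarrow>
     mholomorphic_on \<phi> U \<and>
     (\<forall>v. A_mult e v = (0, 0) \<longrightarrow>
        (\<forall>x\<in>U. D_op e (\<lambda>i. nat (v i)) \<phi> x = D_op e (\<lambda>i. nat (- v i)) \<phi> x)) \<and>
     (\<forall>x\<in>U. (\<Sum>i\<in>UNIV. x $ i * partial i \<phi> x) = of_int (fst \<alpha>) * \<phi> x) \<and>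
     (\<forall>x\<in>U. (\<Sum>i\<in>UNIV. of_nat (e i) * x $ i * partial i \<phi> x) = of_int (snd \<alpha>) * \<phi> x)"

definition f_poly :: "('n::finite \<Rightarrow> nat) \<Rightarrow> complex^'n \<Rightarrow> complex poly" where
  "f_poly e x = (\<Sum>i\<in>UNIV. monom (x $ i) (e i))"

text \<open>
  The discriminant \<open>(-1)^(n(n-1)/2) Res(p, p') / a_n\<close> of a polynomial of degree \<open>n\<close>.  It is applied
  to \<open>f_poly e x\<close> with its actual degree; this is \<open>d\<close> except where \<open>x_d = 0\<close>, and such points belong
  to \<open>\<Sigma>\<close> anyway.
\<close>

definition discriminant :: "complex poly \<Rightarrow> complex" where
  "discriminant p =
     (-1) ^ (degree p * (degree p - 1) div 2) * resultant p (pderiv p) / lead_coeff p"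

definition Sigma_set :: "('n::finite \<Rightarrow> nat) \<Rightarrow> nat \<Rightarrow> (complex^'n) set" where
  "Sigma_set e d =
     {x. (\<exists>i. e i = 0 \<and> x $ i = 0) \<or> (\<exists>i. e i = d \<and> x $ i = 0) \<or> discriminant (f_poly e x) = 0}"

text \<open>The sum is finite, because \<open>\<A> u = \<beta>\<close> prescribes the sum of the entries of \<open>u\<close>.\<close>

definition Phi :: "('n::finite \<Rightarrow> nat) \<Rightarrow> int \<times> int \<Rightarrow> complex^'n \<Rightarrow> complex" where
  "Phi e \<beta> x = (\<Sum>u | A_nmult e u = \<beta>. \<Prod>i\<in>UNIV. x $ i ^ u i / fact (u i))"

text \<open>\<open>\<psi>_\<rho>(\<alpha>)\<close> for \<open>\<alpha>_1 \<ge> 0\<close>, for a root \<open>\<rho>\<close> and a branch \<open>l\<close> of its logarithm.\<close>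

definition psi_nonneg ::
  "('n::finite \<Rightarrow> nat) \<Rightarrow> nat \<Rightarrow> (complex^'n \<Rightarrow> complex) \<Rightarrow> (complex^'n \<Rightarrow> complex) \<Rightarrow>
     int \<times> int \<Rightarrow> complex^'n \<Rightarrow> complex" where
  "psi_nonneg e d \<rho> l \<alpha> x =
     (\<Sum>i\<in>{0..int d * fst \<alpha>} - {snd \<alpha>}.
        Phi e (fst \<alpha>, i) x * (\<rho> x powi (i - snd \<alpha>) / of_int (i - snd \<alpha>)))
     + Phi e \<alpha> x * l x"

text \<open>For \<open>\<alpha>_1 < 0\<close> the function does not depend on the admissible \<open>u\<close>, so some \<open>u\<close> is selected.\<close>

definition psi ::
  "('n::finite \<Rightarrow> nat) \<Rightarrow> nat \<Rightarrow> (complex^'n \<Rightarrow> complex) \<Rightarrow> (complex^'n \<Rightarrow> complex) \<Rightarrow>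
     int \<times> int \<Rightarrow> complex^'n \<Rightarrow> complex" where
  "psi e d \<rho> l \<alpha> =
     (if fst \<alpha> \<ge> 0 then psi_nonneg e d \<rho> l \<alpha>
      else let u = (SOME u. fst (A_nmult e u) \<ge> - fst \<alpha>)
           in D_op e u (psi_nonneg e d \<rho> l (\<alpha> + A_nmult e u)))"

text \<open>
  Complex-valued functions as a complex vector space.  A function on \<open>U\<close> is represented by its
  extension by zero, so that spans and linear relations only concern the values on \<open>U\<close>.
\<close>

definition fun_scale :: "complex \<Rightarrow> ('a \<Rightarrow> complex) \<Rightarrow> 'a \<Rightarrow> complex" where
  "fun_scale c g = (\<lambda>x. c * g x)"

global_interpretation cfun: vector_space "fun_scale :: complex \<Rightarrow> ('a \<Rightarrow> complex) \<Rightarrow> 'a \<Rightarrow> complex"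
  by unfold_locales (auto simp: fun_scale_def fun_eq_iff algebra_simps)

definition on_set :: "'a set \<Rightarrow> ('a \<Rightarrow> complex) \<Rightarrow> 'a \<Rightarrow> complex" where
  "on_set U g = (\<lambda>x. if x \<in> U then g x else 0)"

text \<open>
  Linear dependence of a finite family, counted with repetitions (unlike \<open>cfun.dependent\<close>, which
  speaks about the set of its members).
\<close>

definition dependent_family :: "'i set \<Rightarrow> ('i \<Rightarrow> 'a \<Rightarrow> complex) \<Rightarrow> bool" where
  "dependent_family J F \<longleftrightarrow>
     (\<exists>c. (\<exists>j\<in>J. c j \<noteq> 0) \<and> (\<Sum>j\<in>J. fun_scale (c j) (F j)) = 0)"

end

theory Submission
  imports Defs
begin

text \<open>
  Write \<open>\<psi>(a, b)\<close> for the function attached to one root \<open>\<rho>\<close> of \<open>f(x;t)\<close> and the exponent \<open>(a, b)\<close>.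
  Up to a normalization it is a primitive of \<open>f(x;t)^a t^(-b-1)\<close> evaluated at \<open>t = \<rho>\<close> if
  \<open>a \<ge> 0\<close>, and the residue of the same form at \<open>t = \<rho>\<close> if \<open>a < 0\<close>.  With the normalization
  \<open>(-1)^n (n-1)!\<close> of the residue for \<open>a = -n\<close> (lemma \<open>has_partials_psi_family\<close>) these functions
  satisfy, for all integers \<open>a\<close> and \<open>b\<close>,

    \<open>\<partial>/\<partial>x_i \<psi>(a, b) = \<psi>(a - 1, b - e i)\<close>.

  Everything about the hypergeometric system follows from this single rule.  Applying \<open>D_u\<close>
  subtracts \<open>\<A> u\<close> from the exponent, so the value of \<open>\<psi>\<close> at a negative \<open>a\<close> is the prescribed
  derivative, and both sides of a toric equation are the same function.  The Euler operators
  become sums over shifted exponents.  They can be evaluated for \<open>a \<ge> 0\<close>, and differentiation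
  carries the result to \<open>a < 0\<close>.  The second one produces the defect \<open>- Phi e (a, b)\<close>, coming from
  the logarithm; it is zero for \<open>(a, b)\<close> outside \<open>I_A e\<close>, because no monomial has such an exponent.

  For the linear relations, suppose that \<open>\<Sum>j. c j * \<psi>_j(\<alpha>) = 0\<close> on \<open>U\<close>.  Differentiating gives
  the same relation for every exponent in \<open>\<alpha> - I_A e\<close>.  Since the greatest common divisor is 1, the
  monoid \<open>I_A e\<close> contains every lattice point of its cone that is far enough from the boundary
  (lemma \<open>I_A_contains_cone_interior\<close>).  Hence, at a single point \<open>x\<close> and for large \<open>n\<close>, the weighted
  sum of the residues of \<open>t^p Q(t) / f^n\<close> at the roots vanishes for a fixed \<open>p\<close> and all polynomials \<open>Q\<close>
  up to a degree that falls short of \<open>d n\<close> by a constant only.  For two roots \<open>\<rho>_a\<close> and \<open>\<rho>_b\<close> there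
  is room for
  \<open>Q = (t - \<rho>_b)^(n-1) * (product of (t - \<rho>_k)^n over the remaining roots)\<close>, which reduces the form
  to a constant multiple of \<open>t^p / ((t - \<rho>_a)^n (t - \<rho>_b))\<close>.  This has only two finite poles and, as
  \<open>p < n\<close>, no residue at infinity, so its two residues are opposite; they are nonzero, and
  therefore \<open>c a = c b\<close> (lemma \<open>weights_equal_of_residue_relation\<close>).

  So every relation has constant coefficients.  The relations then form a space of dimension at
  most 1, and a nontrivial one exists precisely when the sum of all \<open>\<psi>_j(\<alpha>)\<close> vanishes.
\<close>

section \<open>Partial derivatives of holomorphic functions\<close>

text \<open>
  Complex differentiability with the gradient recorded.  The calculus below is phrased with this
  relation because it delivers both the holomorphy and the values of \<open>partial\<close> at once.
\<close>

definition has_partials ::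
  "(complex^'n::finite \<Rightarrow> complex) \<Rightarrow> ('n \<Rightarrow> complex) \<Rightarrow> complex^'n \<Rightarrow> bool" where
  "has_partials g D x \<longleftrightarrow> (g has_derivative (\<lambda>v. \<Sum>i\<in>UNIV. D i * v $ i)) (at x)"

lemma has_partials_const: "has_partials (\<lambda>y. c) (\<lambda>i. 0) x"
  by (simp add: has_partials_def)

lemma has_partials_coord:
  fixes x :: "complex^'n::finite"
  shows "has_partials (\<lambda>y. y $ j) (\<lambda>i. if i = j then 1 else 0) x"
proof -
  have "(\<lambda>v::complex^'n. \<Sum>i\<in>UNIV. (if i = j then 1 else 0) * v $ i) = (\<lambda>v. v $ j)"
    by (auto simp: fun_eq_iff if_distrib[of "\<lambda>z. z * _"] cong: if_cong)
  then show ?thesis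
    unfolding has_partials_def
    by (simp add: bounded_linear_imp_has_derivative bounded_linear_vec_nth)
qed

lemma has_partials_add:
  "has_partials f D x \<Longrightarrow> has_partials g E x \<Longrightarrow> has_partials (\<lambda>y. f y + g y) (\<lambda>i. D i + E i) x"
  unfolding has_partials_def
  by (drule (1) has_derivative_add) (simp add: algebra_simps sum.distrib)

lemma has_partials_mult:
  "has_partials f D x \<Longrightarrow> has_partials g E x \<Longrightarrow>
   has_partials (\<lambda>y. f y * g y) (\<lambda>i. D i * g x + f x * E i) x"
  unfolding has_partials_def
  by (drule (1) has_derivative_mult)
     (simp add: algebra_simps sum.distrib sum_distrib_left sum_distrib_right)

lemma has_partials_cmult:
  "has_partials f D x \<Longrightarrow> has_partials (\<lambda>y. c * f y) (\<lambda>i. c * D i) x"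
  using has_partials_mult[OF has_partials_const[of c], of f D] by simp

lemma has_partials_sum:
  assumes "\<And>k. k \<in> A \<Longrightarrow> has_partials (\<lambda>y. f k y) (D k) x"
  shows "has_partials (\<lambda>y. \<Sum>k\<in>A. f k y) (\<lambda>i. \<Sum>k\<in>A. D k i) x"
proof (cases "finite A")
  case True
  then show ?thesis using assms
    by (induction A rule: finite_induct) (auto simp: has_partials_const intro!: has_partials_add)
next
  case False
  then show ?thesis by (simp add: has_partials_const)
qed

lemma has_partials_chain:
  assumes "has_partials g D x" "(h has_field_derivative h') (at (g x))"
  shows "has_partials (\<lambda>y. h (g y)) (\<lambda>i. h' * D i) x"
proof -
  have "((\<lambda>y. h (g y)) has_derivative (\<lambda>v. h' * (\<Sum>i\<in>UNIV. D i * v $ i))) (at x)"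
    using has_derivative_compose[OF assms(1)[unfolded has_partials_def]
        assms(2)[unfolded has_field_derivative_def]] by simp
  then show ?thesis
    unfolding has_partials_def by (simp add: sum_distrib_left mult.assoc)
qed

lemma has_partials_unique:
  fixes x :: "complex^'n::finite"
  assumes "has_partials g D x" "has_partials g E x"
  shows "D = E"
proof
  fix j
  have "(\<lambda>v::complex^'n. \<Sum>i\<in>UNIV. D i * v $ i) = (\<lambda>v. \<Sum>i\<in>UNIV. E i * v $ i)"
    using assms unfolding has_partials_def by (rule has_derivative_unique)
  from fun_cong[OF this, of "axis j 1"] show "D j = E j"
    by (simp add: axis_def if_distrib[of "\<lambda>z. _ * z"] cong: if_cong)
qed

lemma has_partials_transform:
  assumes "has_partials g D x" "open U" "x \<in> U" "\<And>y. y \<in> U \<Longrightarrow> g y = h y"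
  shows "has_partials h D x"
  using has_derivative_transform_within_open[OF assms(1)[unfolded has_partials_def] assms(2-4)]
  by (simp add: has_partials_def)

lemma has_partials_partial:
  fixes x :: "complex^'n::finite"
  assumes "has_partials g D x"
  shows "partial j g x = D j"
proof -
  have "((\<lambda>t. x + axis j t) has_derivative (\<lambda>t. axis j t)) (at 0)"
  proof -
    have "bounded_linear (\<lambda>t::complex. axis j t :: complex^'n)"
      unfolding linear_conv_bounded_linear[symmetric]
      proof (rule linearI)
        show "axis j (a + b) = axis j a + (axis j b :: complex^'n)" for a b
          by (subst Finite_Cartesian_Product.vec_eq_iff) (simp add: axis_def)
        show "axis j (r *\<^sub>R b) = r *\<^sub>R (axis j b :: complex^'n)" for r b
          by (subst Finite_Cartesian_Product.vec_eq_iff) (simp add: axis_def)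
      qed
    then show ?thesis by (auto intro!: derivative_eq_intros bounded_linear_imp_has_derivative)
  qed
  moreover have "(g has_derivative (\<lambda>v. \<Sum>i\<in>UNIV. D i * v $ i)) (at (x + axis j 0))"
  proof -
    have "axis j 0 = (0 :: complex^'n)"
      by (subst Finite_Cartesian_Product.vec_eq_iff) (simp add: axis_def)
    then show ?thesis using assms unfolding has_partials_def by (simp only: add_0_right)
  qed
  ultimately have "((\<lambda>t. g (x + axis j t)) has_derivative
      (\<lambda>t. \<Sum>i\<in>UNIV. D i * axis j t $ i)) (at 0)"
    by (rule has_derivative_compose)
  moreover have "(\<lambda>t. \<Sum>i\<in>UNIV. D i * axis j t $ i) = (\<lambda>t. D j * t)"
    by (simp add: axis_def fun_eq_iff if_distrib[of "\<lambda>z. _ * z"] cong: if_cong)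
  ultimately have "((\<lambda>t. g (x + axis j t)) has_field_derivative D j) (at 0)"
    by (simp add: has_field_derivative_def)
  then show ?thesis unfolding partial_def by (rule DERIV_imp_deriv)
qed

lemma has_partials_imp_mholomorphic:
  assumes "\<And>x. x \<in> U \<Longrightarrow> has_partials g (D x) x"
  shows "mholomorphic_on g U"
  unfolding mholomorphic_on_def
proof
  fix x assume "x \<in> U"
  from assms[OF this] show "\<exists>g'. (g has_derivative g') (at x) \<and> (\<forall>c v. g' (c *s v) = c * g' v)"
    unfolding has_partials_def
    by (intro exI conjI) (assumption, simp add: sum_distrib_left vector_scalar_mult_def ac_simps)
qed

lemma mholomorphic_imp_has_partials:
  assumes "mholomorphic_on g U" "x \<in> U"
  shows "\<exists>D. has_partials g D x"
proof -
  obtain g' where g': "(g has_derivative g') (at x)" and lin: "\<And>c v. g' (c *s v) = c * g' v"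
    using assms unfolding mholomorphic_on_def by blast
  interpret bounded_linear g' using g' by (rule has_derivative_bounded_linear)
  have "g' v = (\<Sum>i\<in>UNIV. g' (axis i 1) * v $ i)" for v
  proof -
    have "g' v = g' (\<Sum>i\<in>UNIV. v $ i *s axis i 1)" by (simp add: basis_expansion)
    also have "\<dots> = (\<Sum>i\<in>UNIV. v $ i * g' (axis i 1))" by (simp add: sum lin)
    finally show ?thesis by (simp add: mult.commute)
  qed
  then have "g' = (\<lambda>v. \<Sum>i\<in>UNIV. g' (axis i 1) * v $ i)" by blast
  with g' show ?thesis unfolding has_partials_def by metis
qed

section \<open>Families of power series with differentiable coefficients\<close>

text \<open>
  Coefficientwise differentiation of a family of power series is a derivation.  It plays the role
  of differentiation under a contour integral: a residue is a coefficient of such a family.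
\<close>

definition fps_partials ::
  "(complex^'n::finite \<Rightarrow> complex fps) \<Rightarrow> ('n \<Rightarrow> complex fps) \<Rightarrow> complex^'n \<Rightarrow> bool" where
  "fps_partials F D x \<longleftrightarrow> (\<forall>k. has_partials (\<lambda>y. fps_nth (F y) k) (\<lambda>i. fps_nth (D i) k) x)"

lemma fps_partials_fps_const:
  assumes "has_partials g D x"
  shows "fps_partials (\<lambda>y. fps_const (g y)) (\<lambda>i. fps_const (D i)) x"
  unfolding fps_partials_def
proof
  fix k
  show "has_partials (\<lambda>y. fps_nth (fps_const (g y)) k) (\<lambda>i. fps_nth (fps_const (D i)) k) x"
    using assms by (cases "k = 0") (simp_all add: has_partials_const)
qed

lemma fps_partials_const: "fps_partials (\<lambda>y. C) (\<lambda>i. 0) x"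
  by (simp add: fps_partials_def has_partials_const)

lemma fps_partials_add:
  "fps_partials F D x \<Longrightarrow> fps_partials G E x \<Longrightarrow> fps_partials (\<lambda>y. F y + G y) (\<lambda>i. D i + E i) x"
  by (simp add: fps_partials_def has_partials_add)

lemma fps_partials_mult:
  assumes "fps_partials F D x" "fps_partials G E x"
  shows "fps_partials (\<lambda>y. F y * G y) (\<lambda>i. D i * G x + F x * E i) x"
  unfolding fps_partials_def
proof
  fix k
  have "has_partials (\<lambda>y. \<Sum>i=0..k. fps_nth (F y) i * fps_nth (G y) (k - i))
     (\<lambda>j. \<Sum>i=0..k. fps_nth (D j) i * fps_nth (G x) (k - i) + fps_nth (F x) i * fps_nth (E j) (k - i)) x"
    using assms unfolding fps_partials_def by (intro has_partials_sum has_partials_mult) auto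
  then show "has_partials (\<lambda>y. fps_nth (F y * G y) k) (\<lambda>i. fps_nth (D i * G x + F x * E i) k) x"
    by (simp add: fps_mult_nth sum.distrib)
qed

lemma fps_partials_sum:
  assumes "\<And>k. k \<in> A \<Longrightarrow> fps_partials (\<lambda>y. F k y) (D k) x"
  shows "fps_partials (\<lambda>y. \<Sum>k\<in>A. F k y) (\<lambda>i. \<Sum>k\<in>A. D k i) x"
  using assms by (auto simp: fps_partials_def fps_sum_nth intro!: has_partials_sum)

lemma fps_partials_power:
  assumes "fps_partials F D x"
  shows "fps_partials (\<lambda>y. F y ^ n) (\<lambda>i. of_nat n * F x ^ (n - 1) * D i) x"
proof (induction n)
  case 0
  then show ?case by (simp add: fps_partials_const)
next
  case (Suc n)
  have "fps_partials (\<lambda>y. F y * F y ^ n)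
      (\<lambda>i. D i * F x ^ n + F x * (of_nat n * F x ^ (n - 1) * D i)) x"
    by (intro fps_partials_mult assms Suc)
  moreover have "D i * F x ^ n + F x * (of_nat n * F x ^ (n - 1) * D i) =
      of_nat (Suc n) * F x ^ (Suc n - 1) * D i" for i
    by (cases n) (simp_all add: algebra_simps)
  ultimately show ?case by simp
qed

lemma fps_partials_unique:
  assumes "fps_partials F D x" "fps_partials F E x"
  shows "D = E"
proof
  fix i
  have "(\<lambda>i. fps_nth (D i) k) = (\<lambda>i. fps_nth (E i) k)" for k
    using assms unfolding fps_partials_def by (blast intro: has_partials_unique)
  then have "fps_nth (D i) k = fps_nth (E i) k" for k by (rule fun_cong)
  then show "D i = E i" by (rule fps_ext)
qed

lemma fps_partials_transform:
  assumes "fps_partials F D x" "open U" "x \<in> U" "\<And>y. y \<in> U \<Longrightarrow> F y = G y"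
  shows "fps_partials G D x"
  unfolding fps_partials_def
proof
  fix k
  show "has_partials (\<lambda>y. fps_nth (G y) k) (\<lambda>i. fps_nth (D i) k) x"
    by (rule has_partials_transform[OF assms(1)[unfolded fps_partials_def, rule_format, of k] assms(2,3)])
       (simp add: assms(4))
qed

lemma has_partials_inverse:
  assumes "has_partials g D x" "g x \<noteq> 0"
  shows "has_partials (\<lambda>y. inverse (g y)) (\<lambda>i. - (inverse (g x) * inverse (g x)) * D i) x"
  using has_partials_chain[OF assms(1) DERIV_inverse[OF assms(2)]]
  by (simp add: power2_eq_square)

lemma fps_inverse_nth_rec:
  fixes F :: "'a::field fps"
  assumes "k > 0"
  shows "fps_nth (inverse F) k =
    (-1) * inverse (fps_nth F 0) * (\<Sum>i=1..k. fps_nth F i * fps_nth (inverse F) (k - i))"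
proof (cases k)
  case 0 then show ?thesis using assms by simp
next
  case (Suc n)
  then show ?thesis unfolding fps_inverse_def by (simp add: sum_distrib_left mult.assoc)
qed

text \<open>
  Differentiability of the coefficients follows by recursion, as each coefficient of an inverse is
  a rational function of finitely many coefficients of the original series.  The value of the
  derivative is then forced by the product rule for \<open>F * inverse F = 1\<close>.
\<close>

lemma fps_partials_inverse:
  assumes F: "fps_partials F D x" and U: "open U" "x \<in> U"
    and nz: "\<And>y. y \<in> U \<Longrightarrow> fps_nth (F y) 0 \<noteq> 0"
  shows "fps_partials (\<lambda>y. inverse (F y)) (\<lambda>i. - (inverse (F x) * inverse (F x)) * D i) x"
proof -
  have Fk: "has_partials (\<lambda>y. fps_nth (F y) k) (\<lambda>i. fps_nth (D i) k) x" for k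
    using F by (simp add: fps_partials_def)
  have "\<exists>E. has_partials (\<lambda>y. fps_nth (inverse (F y)) k) E x" for k
  proof (induction k rule: less_induct)
    case (less k)
    show ?case
    proof (cases "k = 0")
      case True
      then show ?thesis using has_partials_inverse[OF Fk[of 0] nz[OF U(2)]] by auto
    next
      case False
      obtain E where E: "\<And>l. l < k \<Longrightarrow> has_partials (\<lambda>y. fps_nth (inverse (F y)) l) (E l) x"
        using less by metis
      have "\<exists>E'. has_partials (\<lambda>y. ((-1) * inverse (fps_nth (F y) 0)) *
          (\<Sum>i=1..k. fps_nth (F y) i * fps_nth (inverse (F y)) (k - i))) E' x"
      proof (rule exI, rule has_partials_mult)
        show "has_partials (\<lambda>y. (-1) * inverse (fps_nth (F y) 0)) (\<lambda>i. (-1) *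
            (- (inverse (fps_nth (F x) 0) * inverse (fps_nth (F x) 0)) * fps_nth (D i) 0)) x"
          by (intro has_partials_cmult has_partials_inverse Fk nz U)
        show "has_partials (\<lambda>y. \<Sum>i=1..k. fps_nth (F y) i * fps_nth (inverse (F y)) (k - i))
            (\<lambda>j. \<Sum>i=1..k. fps_nth (D j) i * fps_nth (inverse (F x)) (k - i) +
              fps_nth (F x) i * E (k - i) j) x"
          by (intro has_partials_sum has_partials_mult Fk E) auto
      qed
      moreover have "(\<lambda>y. fps_nth (inverse (F y)) k) = (\<lambda>y. ((-1) * inverse (fps_nth (F y) 0)) *
          (\<Sum>i=1..k. fps_nth (F y) i * fps_nth (inverse (F y)) (k - i)))"
        using False fps_inverse_nth_rec by blast
      ultimately show ?thesis by simp
    qed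
  qed
  then obtain E where E: "\<And>k. has_partials (\<lambda>y. fps_nth (inverse (F y)) k) (E k) x" by metis
  define V where "V = (\<lambda>i. Abs_fps (\<lambda>k. E k i))"
  have V: "fps_partials (\<lambda>y. inverse (F y)) V x"
    unfolding fps_partials_def V_def using E by simp
  have "fps_partials (\<lambda>y. F y * inverse (F y)) (\<lambda>i. D i * inverse (F x) + F x * V i) x"
    by (intro fps_partials_mult F V)
  then have "fps_partials (\<lambda>y. 1) (\<lambda>i. D i * inverse (F x) + F x * V i) x"
    by (rule fps_partials_transform[OF _ U]) (simp add: inverse_mult_eq_1' nz)
  then have eq: "D i * inverse (F x) + F x * V i = 0" for i
    using fun_cong[OF fps_partials_unique[OF _ fps_partials_const]] by fastforce
  have "V i = - (inverse (F x) * inverse (F x)) * D i" for i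
  proof -
    have 1: "inverse (F x) * F x = 1" using inverse_mult_eq_1[OF nz[OF U(2)]] .
    have "inverse (F x) * (D i * inverse (F x)) + (inverse (F x) * F x) * V i = 0"
      using eq[of i] by (metis distrib_left mult.assoc mult_zero_right)
    then show ?thesis unfolding 1 by (simp add: algebra_simps eq_neg_iff_add_eq_0)
  qed
  then have "V = (\<lambda>i. - (inverse (F x) * inverse (F x)) * D i)" by blast
  then show ?thesis using V by simp
qed

section \<open>The hypergeometric polynomials\<close>

definition monomial_term :: "('n::finite \<Rightarrow> nat) \<Rightarrow> complex^'n \<Rightarrow> complex" where
  "monomial_term u x = (\<Prod>i\<in>UNIV. x $ i ^ u i / fact (u i))"

definition bump :: "'n \<Rightarrow> ('n \<Rightarrow> nat) \<Rightarrow> 'n \<Rightarrow> nat" where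
  "bump j u = u(j := Suc (u j))"

lemma A_nmult_bump: "A_nmult e (bump j u) = A_nmult e u + (1, int (e j))"
proof -
  have "int (bump j u i) = int (u i) + (if i = j then 1 else 0)" for i
    by (simp add: bump_def)
  then show ?thesis
    by (simp add: A_mult_def sum.distrib algebra_simps if_distrib[of "\<lambda>z. _ * z"] cong: if_cong)
qed

lemma finite_A_fibre: "finite {u :: 'n::finite \<Rightarrow> nat. A_nmult e u = \<beta>}"
proof (rule finite_subset)
  show "{u. A_nmult e u = \<beta>} \<subseteq> PiE UNIV (\<lambda>_. {..nat (fst \<beta>)})"
  proof (clarsimp simp: PiE_def Pi_def)
    fix u :: "'n \<Rightarrow> nat" and i
    have "int (u i) \<le> (\<Sum>i\<in>UNIV. int (u i))" by (rule member_le_sum) auto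
    then show "u i \<le> nat (fst (A_nmult e u))" by (simp add: A_mult_def)
  qed
  show "finite (PiE (UNIV::'n set) (\<lambda>_. {..nat (fst \<beta>)}))" by (intro finite_PiE) auto
qed

lemma Phi_alt: "Phi e \<beta> x = (\<Sum>u | A_nmult e u = \<beta>. monomial_term u x)"
  by (simp add: Phi_def monomial_term_def)

lemma monomial_term_bump:
  "of_nat (Suc (u j)) * monomial_term (bump j u) x = x $ j * monomial_term u x"
proof -
  let ?r = "\<Prod>i\<in>UNIV - {j}. x $ i ^ u i / fact (u i)"
  have "monomial_term (bump j u) x = x $ j ^ Suc (u j) / fact (Suc (u j)) * ?r"
    unfolding monomial_term_def
    by (subst prod.remove[of UNIV j]) (auto simp: bump_def intro!: prod.cong)
  moreover have "monomial_term u x = x $ j ^ u j / fact (u j) * ?r"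
    unfolding monomial_term_def by (subst prod.remove[of UNIV j]) auto
  moreover have "s * (p * q / (s * F) * r) = p * (q / F * r)" if "s \<noteq> 0" for s p q F r :: complex
    using that by simp
  ultimately show ?thesis
    by (simp only: fact_Suc power_Suc of_nat_mult of_nat_eq_0_iff nat.distinct not_False_eq_True)
qed

text \<open>
  Euler's identity for a single variable: \<open>u j\<close> times the monomial of \<open>u\<close> is \<open>x_j\<close> times the
  divided monomial with \<open>u j\<close> lowered by one.  The two homogeneity identities for \<open>Phi\<close> are the
  sums of this one with the weights 1 and \<open>e j\<close>.
\<close>

lemma weighted_fibre_sum:
  "(\<Sum>u | A_nmult e u = \<beta>. of_nat (u j) * monomial_term u x) =
   x $ j * Phi e (\<beta> - (1, int (e j))) x"
proof -
  have "(\<Sum>u | A_nmult e u = \<beta>. of_nat (u j) * monomial_term u x) =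
      (\<Sum>u | A_nmult e u = \<beta> \<and> u j > 0. of_nat (u j) * monomial_term u x)"
    by (rule sum.mono_neutral_right) (auto simp: finite_A_fibre)
  also have "\<dots> = (\<Sum>w | A_nmult e w = \<beta> - (1, int (e j)).
      of_nat (bump j w j) * monomial_term (bump j w) x)"
  proof (rule sum.reindex_bij_witness[of _ "bump j" "\<lambda>u. u(j := u j - 1)"])
    fix u assume u: "u \<in> {u. A_nmult e u = \<beta> \<and> 0 < u j}"
    then show eq: "bump j (u(j := u j - 1)) = u" by (auto simp: bump_def)
    have "A_nmult e u = A_nmult e (u(j := u j - 1)) + (1, int (e j))"
      by (subst eq[symmetric], rule A_nmult_bump)
    then have "A_nmult e (u(j := u j - 1)) = A_nmult e u - (1, int (e j))" by (metis add_diff_cancel_right')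
    then show "u(j := u j - 1) \<in> {w. A_nmult e w = \<beta> - (1, int (e j))}" using u by simp
    show "of_nat (bump j (u(j := u j - 1)) j) * monomial_term (bump j (u(j := u j - 1))) x =
        of_nat (u j) * monomial_term u x" by (simp only: eq)
  next
    fix w assume "w \<in> {w. A_nmult e w = \<beta> - (1, int (e j))}"
    then show "bump j w \<in> {u. A_nmult e u = \<beta> \<and> 0 < u j}"
      by (simp add: A_nmult_bump) (simp add: bump_def)
    show "(bump j w)(j := bump j w j - 1) = w" by (simp add: bump_def)
  qed
  also have "\<dots> = (\<Sum>w | A_nmult e w = \<beta> - (1, int (e j)). x $ j * monomial_term w x)"
    using monomial_term_bump by (intro sum.cong) (auto simp: bump_def)
  finally show ?thesis by (simp add: Phi_alt sum_distrib_left)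
qed

lemma Phi_homogeneous:
  "(\<Sum>j\<in>UNIV. x $ j * Phi e (a - 1, b - int (e j)) x) = of_int a * Phi e (a, b) x"
proof -
  have "(\<Sum>j\<in>UNIV. x $ j * Phi e (a - 1, b - int (e j)) x) =
      (\<Sum>j\<in>UNIV. \<Sum>u | A_nmult e u = (a, b). of_nat (u j) * monomial_term u x)"
    by (simp add: weighted_fibre_sum)
  also have "\<dots> = (\<Sum>u | A_nmult e u = (a, b). \<Sum>j\<in>UNIV. of_nat (u j) * monomial_term u x)"
    by (rule sum.swap)
  also have "\<dots> = (\<Sum>u | A_nmult e u = (a, b). of_int a * monomial_term u x)"
  proof (rule sum.cong[OF refl])
    fix u assume "u \<in> {u. A_nmult e u = (a, b)}"
    then have "a = (\<Sum>j\<in>UNIV. int (u j))" by (simp add: A_mult_def)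
    then show "(\<Sum>j\<in>UNIV. of_nat (u j) * monomial_term u x) = of_int a * monomial_term u x"
      by (simp add: sum_distrib_right)
  qed
  finally show ?thesis by (simp add: Phi_alt sum_distrib_left)
qed

lemma Phi_weighted_homogeneous:
  "(\<Sum>j\<in>UNIV. of_nat (e j) * x $ j * Phi e (a - 1, b - int (e j)) x) = of_int b * Phi e (a, b) x"
proof -
  have "(\<Sum>j\<in>UNIV. of_nat (e j) * x $ j * Phi e (a - 1, b - int (e j)) x) =
      (\<Sum>j\<in>UNIV. of_nat (e j) * (\<Sum>u | A_nmult e u = (a, b). of_nat (u j) * monomial_term u x))"
    by (simp add: weighted_fibre_sum mult.assoc)
  also have "\<dots> = (\<Sum>u | A_nmult e u = (a, b). \<Sum>j\<in>UNIV. of_nat (e j) * of_nat (u j) * monomial_term u x)"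
    unfolding sum_distrib_left mult.assoc by (rule sum.swap)
  also have "\<dots> = (\<Sum>u | A_nmult e u = (a, b). of_int b * monomial_term u x)"
  proof (rule sum.cong[OF refl])
    fix u assume "u \<in> {u. A_nmult e u = (a, b)}"
    then have "b = (\<Sum>j\<in>UNIV. int (e j) * int (u j))" by (simp add: A_mult_def)
    then show "(\<Sum>j\<in>UNIV. of_nat (e j) * of_nat (u j) * monomial_term u x) = of_int b * monomial_term u x"
      by (simp add: sum_distrib_right)
  qed
  finally show ?thesis by (simp add: Phi_alt sum_distrib_left)
qed

lemma Phi_notin_I_A: "\<beta> \<notin> I_A e \<Longrightarrow> Phi e \<beta> x = 0"
  by (auto simp: Phi_def I_A_def intro!: sum.neutral)

lemma I_A_bounds:
  assumes "(a, b) \<in> I_A e" "\<And>i. e i \<le> d"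
  shows "0 \<le> a" "0 \<le> b" "b \<le> int d * a"
proof -
  obtain u where u: "a = (\<Sum>i\<in>UNIV. int (u i))" "b = (\<Sum>i\<in>UNIV. int (e i) * int (u i))"
    using assms(1) by (auto simp: I_A_def A_mult_def)
  show "0 \<le> a" "0 \<le> b" unfolding u by (auto intro!: sum_nonneg)
  show "b \<le> int d * a"
    unfolding u sum_distrib_left using assms(2) by (intro sum_mono mult_right_mono) auto
qed

lemma Phi_negative: "a < 0 \<Longrightarrow> Phi e (a, b) x = 0"
  using I_A_bounds(1)[of a b e "Max (range e)"] by (intro Phi_notin_I_A) fastforce

lemma Phi_zero: "Phi e (0, b) x = (if b = 0 then 1 else 0)"
proof -
  have "A_nmult e u = (0, b) \<longleftrightarrow> u = (\<lambda>i. 0) \<and> b = 0" for u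
    by (auto simp: A_mult_def sum_nonneg_eq_0_iff fun_eq_iff)
  then show ?thesis by (simp add: Phi_def)
qed

text \<open>
  By homogeneity \<open>Phi\<close> of degree \<open>n + 1\<close> is a combination of the functions \<open>Phi\<close> of degree \<open>n\<close> with
  linear coefficients, so the derivative is found by induction on the degree.
\<close>

lemma has_partials_Phi:
  "has_partials (Phi e (a, b)) (\<lambda>i. Phi e (a - 1, b - int (e i)) x) x"
proof (cases "a < 0")
  case True
  then have "Phi e (a, b) = (\<lambda>y. 0)" by (simp add: fun_eq_iff Phi_negative)
  then show ?thesis using True by (simp add: Phi_negative has_partials_const)
next
  case False
  define n where "n = nat a"
  have "has_partials (Phi e (int n, b)) (\<lambda>i. Phi e (int n - 1, b - int (e i)) x) x"
  proof (induction n arbitrary: b)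
    case 0
    have "Phi e (int 0, b) = (\<lambda>y. if b = 0 then 1 else 0)" by (simp add: fun_eq_iff Phi_zero)
    then show ?case by (simp add: Phi_negative has_partials_const)
  next
    case (Suc n)
    have eq: "Phi e (int (Suc n), b) y =
        inverse (of_nat (Suc n)) * (\<Sum>j\<in>UNIV. y $ j * Phi e (int n, b - int (e j)) y)" for y
    proof -
      have "int (Suc n) - 1 = int n" by simp
      with Phi_homogeneous[of y e "int (Suc n)" b] show ?thesis
        by (simp add: field_simps del: of_nat_Suc)
    qed
    have "has_partials (\<lambda>y. inverse (of_nat (Suc n)) * (\<Sum>j\<in>UNIV. y $ j * Phi e (int n, b - int (e j)) y))
       (\<lambda>i. inverse (of_nat (Suc n)) * (\<Sum>j\<in>UNIV. (if i = j then 1 else 0) * Phi e (int n, b - int (e j)) x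
          + x $ j * Phi e (int n - 1, b - int (e j) - int (e i)) x)) x"
      by (intro has_partials_cmult has_partials_sum has_partials_mult has_partials_coord Suc)
    moreover have "inverse (of_nat (Suc n)) * (\<Sum>j\<in>UNIV. (if i = j then 1 else 0) * Phi e (int n, b - int (e j)) x
          + x $ j * Phi e (int n - 1, b - int (e j) - int (e i)) x) = Phi e (int n, b - int (e i)) x" for i
    proof -
      have "(\<Sum>j\<in>UNIV. x $ j * Phi e (int n - 1, b - int (e j) - int (e i)) x) =
          of_nat n * Phi e (int n, b - int (e i)) x"
        using Phi_homogeneous[of x e "int n" "b - int (e i)"] by (simp add: algebra_simps)
      moreover have "(\<Sum>j\<in>UNIV. (if i = j then 1 else 0) * Phi e (int n, b - int (e j)) x) =
          Phi e (int n, b - int (e i)) x"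
        by (simp add: if_distrib[of "\<lambda>z. z * _"] cong: if_cong)
      moreover have "of_nat (Suc n) \<noteq> (0::complex)" by (simp del: of_nat_Suc)
      ultimately show ?thesis
        by (simp add: sum.distrib field_simps)
    qed
    moreover have "Phi e (int (Suc n), b) =
        (\<lambda>y. inverse (of_nat (Suc n)) * (\<Sum>j\<in>UNIV. y $ j * Phi e (int n, b - int (e j)) y))"
      using eq by (rule ext)
    moreover have "int (Suc n) - 1 = int n" by simp
    ultimately show ?case by (simp only:)
  qed
  then show ?thesis using False by (simp add: n_def)
qed

section \<open>Taylor expansions at a moving point\<close>

text \<open>
  The expansion of a polynomial at \<open>r\<close>: the local coordinate is \<open>X = t - r\<close>.
\<close>

definition taylor_shift :: "complex \<Rightarrow> complex poly \<Rightarrow> complex fps" where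
  "taylor_shift r p = fps_of_poly (pcompose p [:r, 1:])"

lemma taylor_shift_mult: "taylor_shift r (p * q) = taylor_shift r p * taylor_shift r q"
  by (simp add: taylor_shift_def pcompose_mult fps_of_poly_mult)

lemma taylor_shift_const: "taylor_shift r [:c:] = fps_const c"
  by (simp add: taylor_shift_def fps_of_poly_const)

lemma taylor_shift_linear: "taylor_shift r [:- s, 1:] = fps_const (r - s) + fps_X"
  by (simp add: taylor_shift_def pcompose_pCons fps_of_poly_linear add.commute)

lemma taylor_shift_power: "taylor_shift r (p ^ n) = taylor_shift r p ^ n"
proof (induction n)
  case 0
  have "taylor_shift r [:1:] = 1" unfolding taylor_shift_const by simp
  then show ?case by (simp add: one_pCons)
qed (simp add: taylor_shift_mult)

lemma taylor_shift_sum: "taylor_shift r (\<Sum>i\<in>A. p i) = (\<Sum>i\<in>A. taylor_shift r (p i))"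
  by (simp add: taylor_shift_def pcompose_sum fps_of_poly_sum)

lemma taylor_shift_prod: "taylor_shift r (\<Prod>i\<in>A. p i) = (\<Prod>i\<in>A. taylor_shift r (p i))"
  by (simp add: taylor_shift_def pcompose_prod fps_of_poly_prod)

lemma taylor_shift_monom:
  "taylor_shift r (monom c k) = fps_const c * (fps_const r + fps_X) ^ k"
proof -
  have "monom c k = [:c:] * [:- 0, 1:] ^ k" by (simp add: monom_altdef)
  then show ?thesis
    by (simp only: taylor_shift_mult taylor_shift_power taylor_shift_const taylor_shift_linear diff_0_right)
qed

lemma taylor_shift_nth_0: "fps_nth (taylor_shift r p) 0 = poly p r"
  by (simp add: taylor_shift_def pcompose_coeff_0)

lemma taylor_shift_pderiv: "fps_deriv (taylor_shift r p) = taylor_shift r (pderiv p)"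
proof -
  have "pderiv [:r, 1:] = 1" by (simp add: pderiv_pCons)
  then show ?thesis
    by (simp add: taylor_shift_def fps_of_poly_pderiv[symmetric] pderiv_pcompose del: pderiv_pCons)
qed

text \<open>
  The binomial series of \<open>(r + X)^s\<close> for an integer \<open>s\<close> of either sign.
\<close>

definition taylor_powi :: "complex \<Rightarrow> int \<Rightarrow> complex fps" where
  "taylor_powi r s = Abs_fps (\<lambda>k. (of_int s gchoose k) * r powi (s - int k))"

lemma taylor_powi_0: "taylor_powi r 0 = 1"
  by (rule fps_ext) (auto simp: taylor_powi_def gbinomial_0 gr0_conv_Suc)

lemma taylor_powi_mult_linear:
  assumes "r \<noteq> 0"
  shows "taylor_powi r s * (fps_const r + fps_X) = taylor_powi r (s + 1)"
proof (rule fps_ext)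
  fix k
  show "fps_nth (taylor_powi r s * (fps_const r + fps_X)) k = fps_nth (taylor_powi r (s + 1)) k"
  proof (cases k)
    case 0
    then show ?thesis using assms by (simp add: taylor_powi_def power_int_add)
  next
    case (Suc m)
    have p: "r powi (s - int (Suc m)) * r = r powi (s - int m)"
      using power_int_add_1[of r "s - int (Suc m)"] assms by simp
    have "fps_nth (taylor_powi r s * (fps_const r + fps_X)) k =
        (of_int s gchoose Suc m) * (r powi (s - int (Suc m)) * r) + (of_int s gchoose m) * r powi (s - int m)"
      using Suc by (simp add: taylor_powi_def distrib_left)
    also have "\<dots> = ((of_int s gchoose Suc m) + (of_int s gchoose m)) * r powi (s - int m)"
      unfolding p by (simp add: distrib_right)
    also have "\<dots> = ((of_int s + 1) gchoose Suc m) * r powi (s - int m)"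
      unfolding gbinomial_Suc_Suc by (simp only: add.commute)
    finally show ?thesis using Suc by (simp add: taylor_powi_def)
  qed
qed

lemma taylor_powi_mult_power:
  assumes "r \<noteq> 0"
  shows "taylor_powi r s * (fps_const r + fps_X) ^ n = taylor_powi r (s + int n)"
proof (induction n)
  case (Suc n)
  have "taylor_powi r s * (fps_const r + fps_X) ^ Suc n =
      (taylor_powi r s * (fps_const r + fps_X) ^ n) * (fps_const r + fps_X)"
    by (simp only: power_Suc2 mult.assoc)
  also have "\<dots> = taylor_powi r (s + int (Suc n))"
    unfolding Suc taylor_powi_mult_linear[OF assms] by (simp add: ac_simps)
  finally show ?case .
qed simp

lemma has_partials_powi:
  assumes "has_partials g D x" "g x \<noteq> 0"
  shows "has_partials (\<lambda>y. g y powi s) (\<lambda>i. of_int s * g x powi (s - 1) * D i) x"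
proof (rule has_partials_chain[OF assms(1)])
  show "((\<lambda>z. z powi s) has_field_derivative of_int s * g x powi (s - 1)) (at (g x))"
  proof -
    have "(\<lambda>y. y * c) = (*) c" for c :: complex by (auto simp: fun_eq_iff)
    then show ?thesis
      using has_derivative_power_int'[OF assms(2), of s UNIV] by (simp add: has_field_derivative_def)
  qed
qed

text \<open>
  Moving the centre of an expansion acts on it as the derivative in the local coordinate.
\<close>

lemma fps_partials_taylor_powi:
  assumes "has_partials g D x" "g x \<noteq> 0"
  shows "fps_partials (\<lambda>y. taylor_powi (g y) s)
    (\<lambda>i. fps_const (D i) * fps_deriv (taylor_powi (g x) s)) x"
  unfolding fps_partials_def
proof
  fix k
  have "has_partials (\<lambda>y. (of_int s gchoose k) * g y powi (s - int k))
      (\<lambda>i. (of_int s gchoose k) * (of_int (s - int k) * g x powi (s - int k - 1) * D i)) x"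
    by (intro has_partials_cmult has_partials_powi assms)
  moreover have "(of_int s gchoose k) * (of_int (s - int k) * g x powi (s - int k - 1) * D i) =
      fps_nth (fps_const (D i) * fps_deriv (taylor_powi (g x) s)) k" for i
  proof -
    have "(of_int s gchoose k) * of_int (s - int k) = of_nat (Suc k) * (of_int s gchoose Suc k :: complex)"
      using gbinomial_mult_1[of "of_int s :: complex" k] by (simp add: algebra_simps)
    note E = this
    have "(of_int s gchoose k) * (of_int (s - int k) * g x powi (s - int k - 1) * D i) =
        ((of_int s gchoose k) * of_int (s - int k)) * (g x powi (s - int k - 1) * D i)"
      by (simp only: mult.assoc)
    also have "\<dots> = D i * (of_nat (Suc k) * ((of_int s gchoose Suc k) * g x powi (s - int (Suc k))))"
    proof -
      have "s - int k - 1 = s - int (Suc k)" by simp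
      then show ?thesis unfolding E by (simp only: mult_ac)
    qed
    also have "\<dots> = fps_nth (fps_const (D i) * fps_deriv (taylor_powi (g x) s)) k"
      by (simp add: taylor_powi_def)
    finally show ?thesis .
  qed
  moreover have "(\<lambda>y. (of_int s gchoose k) * g y powi (s - int k)) = (\<lambda>y. fps_nth (taylor_powi (g y) s) k)"
    by (simp add: taylor_powi_def)
  ultimately show "has_partials (\<lambda>y. fps_nth (taylor_powi (g y) s) k)
      (\<lambda>i. fps_nth (fps_const (D i) * fps_deriv (taylor_powi (g x) s)) k) x"
    by (simp only:)
qed

section \<open>Residues at a root and their derivatives\<close>

text \<open>
  The unit \<open>g\<close> in \<open>f(x; r + X) = X g\<close> when \<open>r\<close> is a simple root.
\<close>

definition root_cofactor :: "('n::finite \<Rightarrow> nat) \<Rightarrow> complex \<Rightarrow> complex^'n \<Rightarrow> complex fps" where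
  "root_cofactor e r x = fps_shift 1 (taylor_shift r (f_poly e x))"

lemma root_cofactor_mult:
  assumes "poly (f_poly e x) r = 0"
  shows "fps_X * root_cofactor e r x = taylor_shift r (f_poly e x)"
proof (rule fps_ext)
  fix k show "fps_nth (fps_X * root_cofactor e r x) k = fps_nth (taylor_shift r (f_poly e x)) k"
    using assms by (cases k) (auto simp: root_cofactor_def taylor_shift_nth_0)
qed

lemma root_cofactor_nth_0: "fps_nth (root_cofactor e r x) 0 = poly (pderiv (f_poly e x)) r"
  unfolding taylor_shift_nth_0[symmetric] taylor_shift_pderiv[symmetric]
  by (simp add: root_cofactor_def)

text \<open>
  Since \<open>f(x; \<rho> + X) = X g\<close>, the coefficient of \<open>X^(n-1)\<close> in \<open>(\<rho> + X)^(-b-1) g^(-n)\<close> is the residue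
  of \<open>t^(-b-1) / f(x;t)^n\<close> at \<open>t = \<rho>\<close>.  The function is meant for \<open>n > 0\<close>.
\<close>

definition psi_neg ::
  "('n::finite \<Rightarrow> nat) \<Rightarrow> (complex^'n \<Rightarrow> complex) \<Rightarrow> nat \<Rightarrow> int \<Rightarrow> complex^'n \<Rightarrow> complex" where
  "psi_neg e \<rho> n b x = (-1) ^ n * fact (n - 1) *
     fps_nth (taylor_powi (\<rho> x) (- b - 1) * inverse (root_cofactor e (\<rho> x) x) ^ n) (n - 1)"

text \<open>
  The residue of a derivative is zero.  Here \<open>W V^(m+1)\<close> is the integrand \<open>W / f^(m+1)\<close> freed from its
  pole, \<open>c\<close> is the velocity of the root, and \<open>T\<close> is the derivative of \<open>f\<close> in the direction considered.
  The derivative of the integrand at the moving centre is \<open>- (m+1) W T / f^(m+2)\<close> plus \<open>c\<close> times a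
  derivative in \<open>X\<close>, and only the first part has a residue.
\<close>

lemma residue_derivative_identity:
  fixes W V g T D :: "complex fps"
  assumes Vg: "V * g = 1" and g0: "fps_nth g 0 \<noteq> 0" and V: "V = inverse g"
    and XD: "fps_X * D = T + fps_const c * fps_deriv (fps_X * g)"
  shows "fps_nth (fps_const c * fps_deriv W * V ^ Suc m
           + W * (of_nat (Suc m) * V ^ m * (- (V * V) * D))) m =
         - of_nat (Suc m) * fps_nth (W * T * V ^ Suc (Suc m)) (Suc m)"
proof -
  define P where "P = V ^ m"
  define N where "N = (of_nat (Suc m) :: complex fps)"
  define C where "C = fps_const c"
  define H where "H = W * V ^ Suc m"
  have V': "fps_deriv V = - fps_deriv g * (V * V)"
    unfolding V using fps_inverse_deriv[OF g0] by (simp add: power2_eq_square)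
  have H': "fps_deriv H = fps_deriv W * (V * P) + W * (N * P * (- fps_deriv g * (V * V)))"
  proof -
    have "fps_deriv (V ^ Suc m) = N * fps_deriv V * P"
      using fps_deriv_power'[of V "Suc m"] by (simp add: N_def P_def del: power_Suc of_nat_Suc)
    then show ?thesis
      unfolding H_def V'[symmetric] fps_deriv_mult by (simp add: P_def mult_ac add.commute)
  qed
  have XD': "fps_X * D = T + C * (g + fps_X * fps_deriv g)"
    using XD by (simp add: C_def add.commute)
  \<comment> \<open>Multiplying by \<open>X\<close> turns the vanishing residue into the coefficient of \<open>X H' - (m+1) H\<close> at \<open>X^(m+1)\<close>.\<close>
  have "fps_X * (C * fps_deriv W * (V * P) + W * (N * P * (- (V * V) * D))) =
      C * fps_deriv W * (V * P) * fps_X - W * N * P * (V * V) * (fps_X * D)"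
    by (simp add: algebra_simps)
  also have "\<dots> = C * fps_deriv W * (V * P) * fps_X - W * N * P * (V * V) * T
      - C * W * N * P * V * (V * g) - C * W * N * P * (V * V) * fps_X * fps_deriv g"
    unfolding XD' by (simp add: algebra_simps)
  also have "\<dots> = C * (fps_X * fps_deriv H - N * H) - N * (W * T * (V * (V * P)))"
    unfolding H' Vg by (simp add: H_def P_def algebra_simps)
  finally have "fps_nth (fps_X * (C * fps_deriv W * (V * P) + W * (N * P * (- (V * V) * D)))) (Suc m) =
      fps_nth (C * (fps_X * fps_deriv H - N * H) - N * (W * T * (V * (V * P)))) (Suc m)"
    by simp
  moreover have "fps_nth (fps_X * fps_deriv H - N * H) (Suc m) = 0"
    by (simp add: N_def fps_of_nat[symmetric] del: of_nat_Suc)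
  ultimately show ?thesis
    by (simp add: P_def N_def C_def fps_of_nat[symmetric] del: of_nat_Suc)
qed

text \<open>
  A nonvanishing simple root \<open>\<rho>\<close> with gradient \<open>R\<close>, and a function \<open>l\<close> with the gradient of
  \<open>log \<rho>\<close>.
\<close>

locale root_branch =
  fixes e :: "'n::finite \<Rightarrow> nat" and d :: nat and U :: "(complex^'n) set"
    and \<rho> l :: "complex^'n \<Rightarrow> complex" and R :: "complex^'n \<Rightarrow> 'n \<Rightarrow> complex"
  assumes open_U: "open U"
    and e_le: "e i \<le> d"
    and root_partials: "x \<in> U \<Longrightarrow> has_partials \<rho> (R x) x"
    and log_partials: "x \<in> U \<Longrightarrow> has_partials l (\<lambda>i. R x i / \<rho> x) x"
    and root_nonzero: "x \<in> U \<Longrightarrow> \<rho> x \<noteq> 0"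
    and root: "x \<in> U \<Longrightarrow> poly (f_poly e x) (\<rho> x) = 0"
    and simple_root: "x \<in> U \<Longrightarrow> poly (pderiv (f_poly e x)) (\<rho> x) \<noteq> 0"
begin

lemma fps_partials_taylor_shift:
  assumes "x \<in> U"
  shows "fps_partials (\<lambda>y. taylor_shift (\<rho> y) (f_poly e y))
    (\<lambda>i. (fps_const (\<rho> x) + fps_X) ^ e i + fps_const (R x i) * fps_deriv (taylor_shift (\<rho> x) (f_poly e x))) x"
proof -
  have sh: "taylor_shift r (f_poly e y) = (\<Sum>j\<in>UNIV. fps_const (y $ j) * (fps_const r + fps_X) ^ e j)" for r y
    by (simp add: f_poly_def taylor_shift_sum taylor_shift_monom)
  let ?L = "fps_const (\<rho> x) + fps_X"
  have "fps_partials (\<lambda>y. \<Sum>j\<in>UNIV. fps_const (y $ j) * (fps_const (\<rho> y) + fps_X) ^ e j)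
     (\<lambda>i. \<Sum>j\<in>UNIV. fps_const (if i = j then 1 else 0) * ?L ^ e j +
        fps_const (x $ j) * (of_nat (e j) * ?L ^ (e j - 1) * (fps_const (R x i) + 0))) x"
    by (intro fps_partials_sum fps_partials_mult fps_partials_fps_const has_partials_coord
        fps_partials_power fps_partials_add root_partials assms fps_partials_const)
  moreover have "(\<Sum>j\<in>UNIV. fps_const (if i = j then 1 else 0) * ?L ^ e j +
        fps_const (x $ j) * (of_nat (e j) * ?L ^ (e j - 1) * (fps_const (R x i) + 0))) =
      ?L ^ e i + fps_const (R x i) * fps_deriv (taylor_shift (\<rho> x) (f_poly e x))" for i
  proof -
    have 1: "(\<Sum>j\<in>UNIV. fps_const (if i = j then 1 else 0) * ?L ^ e j) = ?L ^ e i"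
      by (subst sum.remove[of _ i]) auto
    have 2: "fps_deriv (taylor_shift (\<rho> x) (f_poly e x)) =
        (\<Sum>j\<in>UNIV. fps_const (x $ j) * (of_nat (e j) * ?L ^ (e j - 1)))"
      unfolding sh by (simp add: fps_deriv_sum fps_deriv_power' mult.assoc)
    show ?thesis unfolding sum.distrib 1 2 sum_distrib_left by (simp add: mult_ac)
  qed
  ultimately show ?thesis by (simp add: sh)
qed

text \<open>
  Implicit differentiation of \<open>f(x; \<rho>(x)) = 0\<close>.
\<close>

lemma root_implicit_derivative:
  assumes "x \<in> U"
  shows "R x i = - (\<rho> x ^ e i) / poly (pderiv (f_poly e x)) (\<rho> x)"
proof -
  have "has_partials (\<lambda>y. fps_nth (taylor_shift (\<rho> y) (f_poly e y)) 0)
      (\<lambda>i. \<rho> x ^ e i + R x i * poly (pderiv (f_poly e x)) (\<rho> x)) x"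
    using fps_partials_taylor_shift[OF assms] unfolding fps_partials_def taylor_shift_pderiv
    by (drule_tac spec[of _ 0]) (simp add: taylor_shift_nth_0 fps_power_zeroth)
  then have "has_partials (\<lambda>y. 0) (\<lambda>i. \<rho> x ^ e i + R x i * poly (pderiv (f_poly e x)) (\<rho> x)) x"
    by (rule has_partials_transform[OF _ open_U assms]) (simp add: taylor_shift_nth_0 root)
  from fun_cong[OF has_partials_unique[OF this has_partials_const], of i]
  have "R x i * poly (pderiv (f_poly e x)) (\<rho> x) = - (\<rho> x ^ e i)"
    by (simp add: eq_neg_iff_add_eq_0 add.commute)
  then show ?thesis using simple_root[OF assms] by (simp add: field_simps)
qed

lemma has_partials_psi_neg:
  assumes x: "x \<in> U" and n: "n > 0"
  shows "has_partials (psi_neg e \<rho> n b) (\<lambda>i. psi_neg e \<rho> (Suc n) (b - int (e i)) x) x"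
proof -
  obtain m where m: "n = Suc m" using n gr0_implies_Suc by blast
  let ?g = "\<lambda>y. root_cofactor e (\<rho> y) y"
  let ?W = "taylor_powi (\<rho> x) (- b - 1)" and ?V = "inverse (?g x)"
  let ?L = "fps_const (\<rho> x) + fps_X"
  have g0: "fps_nth (?g y) 0 \<noteq> 0" if "y \<in> U" for y
    using simple_root[OF that] by (simp add: root_cofactor_nth_0)
  define F where "F = (\<lambda>i. ?L ^ e i + fps_const (R x i) * fps_deriv (taylor_shift (\<rho> x) (f_poly e x)))"
  define D where "D = (\<lambda>i. fps_shift 1 (F i))"
  have D: "fps_partials ?g D x"
    unfolding fps_partials_def
  proof
    fix k
    show "has_partials (\<lambda>y. fps_nth (?g y) k) (\<lambda>i. fps_nth (D i) k) x"
      using fps_partials_taylor_shift[OF x, unfolded fps_partials_def, rule_format, of "Suc k"]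
      by (simp add: root_cofactor_def D_def F_def)
  qed
  \<comment> \<open>The constant term is the derivative of \<open>f(x; \<rho>(x)) = 0\<close>, so \<open>F i\<close> is divisible by \<open>X\<close>.\<close>
  have F0: "fps_nth (F i) 0 = 0" for i
    unfolding F_def taylor_shift_pderiv
    using root_implicit_derivative[OF x, of i] simple_root[OF x]
    by (simp add: taylor_shift_nth_0 fps_power_zeroth)
  have XD: "fps_X * D i = ?L ^ e i + fps_const (R x i) * fps_deriv (fps_X * ?g x)" for i
  proof -
    have "fps_X * D i = F i"
    proof (rule fps_ext)
      fix k show "fps_nth (fps_X * D i) k = fps_nth (F i) k"
        using F0[of i] by (cases k) (simp_all add: D_def)
    qed
    then show ?thesis unfolding root_cofactor_mult[OF root[OF x]] F_def .
  qed
  have *: "fps_partials (\<lambda>y. taylor_powi (\<rho> y) (- b - 1) * inverse (?g y) ^ n)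
     (\<lambda>i. fps_const (R x i) * fps_deriv ?W * ?V ^ n + ?W * (of_nat n * ?V ^ (n - 1) * (- (?V * ?V) * D i))) x"
    by (intro fps_partials_mult fps_partials_taylor_powi fps_partials_power
        fps_partials_inverse[OF D open_U x g0] root_partials root_nonzero x)
  have "has_partials (\<lambda>y. (-1) ^ n * fact m *
        fps_nth (taylor_powi (\<rho> y) (- b - 1) * inverse (?g y) ^ n) m)
     (\<lambda>i. (-1) ^ n * fact m *
        fps_nth (fps_const (R x i) * fps_deriv ?W * ?V ^ Suc m +
          ?W * (of_nat (Suc m) * ?V ^ m * (- (?V * ?V) * D i))) m) x"
    using *[unfolded fps_partials_def, rule_format, of m] m by (intro has_partials_cmult) simp
  moreover have "(-1) ^ n * fact m *
        fps_nth (fps_const (R x i) * fps_deriv ?W * ?V ^ Suc m +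
          ?W * (of_nat (Suc m) * ?V ^ m * (- (?V * ?V) * D i))) m =
      psi_neg e \<rho> (Suc n) (b - int (e i)) x" for i
  proof -
    have "?W * ?L ^ e i = taylor_powi (\<rho> x) (- (b - int (e i)) - 1)"
      unfolding taylor_powi_mult_power[OF root_nonzero[OF x]] by (simp add: algebra_simps)
    then show ?thesis
      unfolding residue_derivative_identity[OF inverse_mult_eq_1[OF g0[OF x]] g0[OF x] refl XD]
      by (simp add: psi_neg_def m algebra_simps del: power_Suc of_nat_Suc) (simp add: algebra_simps)
  qed
  moreover have "psi_neg e \<rho> n b = (\<lambda>y. (-1) ^ n * fact m *
        fps_nth (taylor_powi (\<rho> y) (- b - 1) * inverse (?g y) ^ n) m)"
    by (simp add: fun_eq_iff psi_neg_def m)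
  ultimately show ?thesis by simp
qed

end

section \<open>The logarithmic functions of nonnegative order\<close>

text \<open>
  The primitive of \<open>t^(i-b-1)\<close> at \<open>t = \<rho>\<close>, with \<open>l\<close> as the logarithm in the exceptional case.  With
  it the two parts of \<open>psi_nonneg\<close> become a single sum.
\<close>

definition log_kernel ::
  "(complex^'n::finite \<Rightarrow> complex) \<Rightarrow> (complex^'n \<Rightarrow> complex) \<Rightarrow> int \<Rightarrow> int \<Rightarrow> complex^'n \<Rightarrow> complex" where
  "log_kernel \<rho> l b i x = (if i = b then l x else \<rho> x powi (i - b) / of_int (i - b))"

lemma log_kernel_shift: "log_kernel \<rho> l b (i + s) x = log_kernel \<rho> l (b - s) i x"
  by (auto simp: log_kernel_def algebra_simps)

lemma psi_nonneg_eq_sum: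
  assumes "\<And>i. e i \<le> d"
  shows "psi_nonneg e d \<rho> l (a, b) x =
    (\<Sum>i\<in>{0..int d * a}. Phi e (a, i) x * log_kernel \<rho> l b i x)"
proof -
  let ?S = "{0..int d * a}"
  have "psi_nonneg e d \<rho> l (a, b) x =
      (\<Sum>i\<in>?S - {b}. Phi e (a, i) x * log_kernel \<rho> l b i x) + Phi e (a, b) x * log_kernel \<rho> l b b x"
    unfolding psi_nonneg_def by (auto simp: log_kernel_def intro!: sum.cong)
  also have "\<dots> = (\<Sum>i\<in>insert b ?S. Phi e (a, i) x * log_kernel \<rho> l b i x)"
    by (simp add: sum.insert_remove)
  also have "\<dots> = (\<Sum>i\<in>?S. Phi e (a, i) x * log_kernel \<rho> l b i x)"
  proof (rule sum.mono_neutral_right)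
    show "\<forall>i\<in>insert b ?S - ?S. Phi e (a, i) x * log_kernel \<rho> l b i x = 0"
    proof
      fix i assume "i \<in> insert b ?S - ?S"
      then have "(a, i) \<notin> I_A e" using I_A_bounds[of a i e d] assms by auto
      then show "Phi e (a, i) x * log_kernel \<rho> l b i x = 0" by (simp add: Phi_notin_I_A)
    qed
  qed auto
  finally show ?thesis .
qed

lemma Phi_sum_shift:
  assumes "\<And>i. e i \<le> d"
  shows "(\<Sum>i\<in>{0..int d * a}. Phi e (a - 1, i - int (e j)) x * k i) =
    (\<Sum>i\<in>{0..int d * (a - 1)}. Phi e (a - 1, i) x * k (i + int (e j)))"
proof -
  have "(\<Sum>i\<in>{0..int d * a}. Phi e (a - 1, i - int (e j)) x * k i) =
      (\<Sum>i\<in>{- int (e j)..int d * a - int (e j)}. Phi e (a - 1, i) x * k (i + int (e j)))"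
    by (rule sum.reindex_bij_witness[of _ "\<lambda>i. i + int (e j)" "\<lambda>i. i - int (e j)"]) auto
  also have "\<dots> = (\<Sum>i\<in>{0..int d * (a - 1)}. Phi e (a - 1, i) x * k (i + int (e j)))"
  proof (rule sum.mono_neutral_right)
    show "{0..int d * (a - 1)} \<subseteq> {- int (e j)..int d * a - int (e j)}"
      using assms[of j] by (auto simp: algebra_simps)
    show "\<forall>i\<in>{- int (e j)..int d * a - int (e j)} - {0..int d * (a - 1)}.
        Phi e (a - 1, i) x * k (i + int (e j)) = 0"
    proof
      fix i assume "i \<in> {- int (e j)..int d * a - int (e j)} - {0..int d * (a - 1)}"
      then have "(a - 1, i) \<notin> I_A e" using I_A_bounds[of "a - 1" i e d] assms by auto
      then show "Phi e (a - 1, i) x * k (i + int (e j)) = 0" by (simp add: Phi_notin_I_A)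
    qed
  qed auto
  finally show ?thesis .
qed

lemma poly_f_poly: "poly (f_poly e x) r = (\<Sum>i\<in>UNIV. x $ i * r ^ e i)"
  by (simp add: f_poly_def poly_sum poly_monom)

lemma poly_pderiv_f_poly: "r * poly (pderiv (f_poly e x)) r = (\<Sum>i\<in>UNIV. of_nat (e i) * x $ i * r ^ e i)"
proof -
  have *: "r * (of_nat k * c * r ^ (k - Suc 0)) = of_nat k * c * r ^ k" for k and c :: complex
    by (cases k) auto
  show ?thesis
    by (simp add: f_poly_def pderiv_sum poly_sum pderiv_monom poly_monom sum_distrib_left *)
qed

text \<open>
  The sum is \<open>f(x;r)^a / a!\<close>.  Only its vanishing at a root matters, and for this one factor \<open>f(x;r)\<close>
  split off by homogeneity is enough.
\<close>

lemma Phi_sum_at_root: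
  assumes e: "\<And>i. e i \<le> d" and root: "poly (f_poly e x) r = 0" and r: "r \<noteq> 0" and a: "a > 0"
  shows "(\<Sum>i\<in>{0..int d * a}. Phi e (a, i) x * r powi i) = 0"
proof -
  let ?P = "\<Sum>i\<in>{0..int d * (a - 1)}. Phi e (a - 1, i) x * r powi i"
  have "of_int a * (\<Sum>i\<in>{0..int d * a}. Phi e (a, i) x * r powi i) =
      (\<Sum>i\<in>{0..int d * a}. \<Sum>j\<in>UNIV. x $ j * Phi e (a - 1, i - int (e j)) x * r powi i)"
    unfolding sum_distrib_right[symmetric] Phi_homogeneous by (simp add: sum_distrib_left mult.assoc)
  also have "\<dots> = (\<Sum>j\<in>UNIV. x $ j * (\<Sum>i\<in>{0..int d * a}. Phi e (a - 1, i - int (e j)) x * r powi i))"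
    by (subst sum.swap) (simp add: sum_distrib_left mult.assoc)
  also have "\<dots> = (\<Sum>j\<in>UNIV. x $ j * (r ^ e j * ?P))"
    unfolding Phi_sum_shift[where e=e, OF e] using r
    by (simp add: power_int_add sum_distrib_left mult_ac)
  also have "\<dots> = poly (f_poly e x) r * ?P"
    by (simp add: poly_f_poly sum_distrib_right mult.assoc)
  finally show ?thesis using root a by simp
qed

section \<open>One family of functions for all exponents\<close>

definition psi_family ::
  "('n::finite \<Rightarrow> nat) \<Rightarrow> nat \<Rightarrow> (complex^'n \<Rightarrow> complex) \<Rightarrow> (complex^'n \<Rightarrow> complex) \<Rightarrow>
     int \<times> int \<Rightarrow> complex^'n \<Rightarrow> complex" where
  "psi_family e d \<rho> l \<alpha> =
     (if fst \<alpha> \<ge> 0 then psi_nonneg e d \<rho> l \<alpha> else psi_neg e \<rho> (nat (- fst \<alpha>)) (snd \<alpha>))"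

lemma (in linorder) sorted_key_list_of_finite_type:
  fixes f :: "'b::finite \<Rightarrow> 'a"
  assumes "inj f"
  shows "set (sorted_key_list_of_set f UNIV) = UNIV" "distinct (sorted_key_list_of_set f UNIV)"
proof -
  interpret folding_insort_key "(\<le>)" "(<)" UNIV f
    using assms by unfold_locales
  show "set (sorted_key_list_of_set f UNIV) = UNIV" by simp
  show "distinct (sorted_key_list_of_set f UNIV)"
    using distinct_sorted_key_list_of_set[of UNIV] by (simp add: distinct_map)
qed

context root_branch
begin

abbreviation "fam a b \<equiv> psi_family e d \<rho> l (a, b)"

lemma has_partials_log_kernel:
  assumes x: "x \<in> U"
  shows "has_partials (log_kernel \<rho> l b i) (\<lambda>j. \<rho> x powi (i - b - 1) * R x j) x"
proof (cases "i = b")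
  case True
  then have "log_kernel \<rho> l b i = l" by (simp add: log_kernel_def fun_eq_iff)
  then show ?thesis using log_partials[OF x] True root_nonzero[OF x]
    by (simp add: field_simps)
next
  case False
  then have 1: "log_kernel \<rho> l b i = (\<lambda>y. inverse (of_int (i - b)) * \<rho> y powi (i - b))"
    by (simp add: log_kernel_def fun_eq_iff field_simps)
  have "has_partials (\<lambda>y. inverse (of_int (i - b)) * \<rho> y powi (i - b))
      (\<lambda>j. inverse (of_int (i - b)) * (of_int (i - b) * \<rho> x powi (i - b - 1) * R x j)) x"
    by (intro has_partials_cmult has_partials_powi root_partials root_nonzero x)
  moreover have "inverse (of_int (i - b)) * (of_int (i - b) * z * w) = z * w" for z w :: complex
    using False by (simp add: field_simps)
  ultimately show ?thesis unfolding 1 by (simp only:)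
qed

text \<open>
  Differentiating the coefficients lowers the exponent.  Differentiating the root contributes
  \<open>\<rho>^(-b-1)\<close> times \<open>f(x;\<rho>)^a / a!\<close>, which survives only for \<open>a = 0\<close>, where it becomes the residue of
  order one.
\<close>

lemma has_partials_psi_nonneg:
  assumes x: "x \<in> U"
  shows "has_partials (psi_nonneg e d \<rho> l (a, b))
    (\<lambda>j. psi_nonneg e d \<rho> l (a - 1, b - int (e j)) x
       + \<rho> x powi (- b - 1) * R x j * (\<Sum>i\<in>{0..int d * a}. Phi e (a, i) x * \<rho> x powi i)) x"
proof -
  have "has_partials (\<lambda>y. \<Sum>i\<in>{0..int d * a}. Phi e (a, i) y * log_kernel \<rho> l b i y)
     (\<lambda>j. \<Sum>i\<in>{0..int d * a}. Phi e (a - 1, i - int (e j)) x * log_kernel \<rho> l b i x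
        + Phi e (a, i) x * (\<rho> x powi (i - b - 1) * R x j)) x"
    by (intro has_partials_sum has_partials_mult has_partials_Phi has_partials_log_kernel x)
  moreover have "(\<Sum>i\<in>{0..int d * a}. Phi e (a - 1, i - int (e j)) x * log_kernel \<rho> l b i x
        + Phi e (a, i) x * (\<rho> x powi (i - b - 1) * R x j)) =
      psi_nonneg e d \<rho> l (a - 1, b - int (e j)) x
       + \<rho> x powi (- b - 1) * R x j * (\<Sum>i\<in>{0..int d * a}. Phi e (a, i) x * \<rho> x powi i)" for j
  proof -
    have "\<rho> x powi (i - b - 1) = \<rho> x powi (- b - 1) * \<rho> x powi i" for i
      using root_nonzero[OF x] by (simp add: power_int_add[symmetric] algebra_simps)
    then show ?thesis
      unfolding sum.distrib Phi_sum_shift[where e=e, OF e_le] psi_nonneg_eq_sum[where e=e, OF e_le] log_kernel_shift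
      by (simp add: sum_distrib_left mult_ac)
  qed
  moreover have "psi_nonneg e d \<rho> l (a, b) =
      (\<lambda>y. \<Sum>i\<in>{0..int d * a}. Phi e (a, i) y * log_kernel \<rho> l b i y)"
    by (rule ext) (rule psi_nonneg_eq_sum[where e=e, OF e_le])
  ultimately show ?thesis by (simp only:)
qed

lemma psi_neg_1:
  assumes "x \<in> U"
  shows "psi_neg e \<rho> 1 (b - int (e j)) x = \<rho> x powi (- b - 1) * R x j"
proof -
  have "\<rho> x powi (- (b - int (e j)) - 1) = \<rho> x powi (- b - 1) * \<rho> x ^ e j"
    using root_nonzero[OF assms] power_int_add[of "\<rho> x" "- b - 1" "int (e j)"]
    by (simp add: algebra_simps)
  then show ?thesis
    by (simp add: psi_neg_def taylor_powi_def root_cofactor_nth_0 root_implicit_derivative[OF assms]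
        divide_inverse)
qed

lemma has_partials_psi_family:
  assumes x: "x \<in> U"
  shows "has_partials (fam a b) (\<lambda>i. fam (a - 1) (b - int (e i)) x) x"
proof -
  consider "a > 0" | "a = 0" | "a < 0" by linarith
  then show ?thesis
  proof cases
    case 1
    then show ?thesis
      using has_partials_psi_nonneg[OF x, of a b]
        Phi_sum_at_root[where e=e, OF e_le root[OF x] root_nonzero[OF x] 1]
      by (simp add: psi_family_def)
  next
    case 2
    have "psi_nonneg e d \<rho> l (- 1, b') x = 0" for b'
      by (simp add: psi_nonneg_eq_sum[where e=e, OF e_le] Phi_negative)
    then show ?thesis
      using has_partials_psi_nonneg[OF x, of 0 b] psi_neg_1[OF x, of b] 2
      by (simp add: psi_family_def Phi_zero)
  next
    case 3
    then show ?thesis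
      using has_partials_psi_neg[OF x, of "nat (- a)" b]
      by (simp add: psi_family_def nat_diff_distrib' Suc_nat_eq_nat_zadd1 add.commute)
  qed
qed

section \<open>The Euler equations\<close>

lemma euler_1_nonneg:
  assumes x: "x \<in> U" and a: "a \<ge> 0"
  shows "(\<Sum>j\<in>UNIV. x $ j * fam (a - 1) (b - int (e j)) x) = of_int a * fam a b x"
proof (cases "a = 0")
  case True
  have "(\<Sum>j\<in>UNIV. x $ j * fam (a - 1) (b - int (e j)) x) =
      (\<Sum>j\<in>UNIV. x $ j * (\<rho> x powi (- b - 1) * R x j))"
    using True psi_neg_1[OF x] by (simp add: psi_family_def)
  also have "\<dots> = - (\<rho> x powi (- b - 1) / poly (pderiv (f_poly e x)) (\<rho> x)) * poly (f_poly e x) (\<rho> x)"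
    by (simp add: root_implicit_derivative[OF x] poly_f_poly sum_distrib_left sum_negf sum_divide_distrib mult_ac)
  finally show ?thesis using root[OF x] True by simp
next
  case False
  have "(\<Sum>j\<in>UNIV. x $ j * fam (a - 1) (b - int (e j)) x) =
      (\<Sum>j\<in>UNIV. x $ j * (\<Sum>i\<in>{0..int d * a}. Phi e (a - 1, i - int (e j)) x * log_kernel \<rho> l b i x))"
    unfolding Phi_sum_shift[where e=e, OF e_le] log_kernel_shift
    using False a by (simp add: psi_family_def psi_nonneg_eq_sum[where e=e, OF e_le])
  also have "\<dots> = (\<Sum>i\<in>{0..int d * a}. \<Sum>j\<in>UNIV. x $ j * Phi e (a - 1, i - int (e j)) x * log_kernel \<rho> l b i x)"
    by (subst sum.swap) (simp add: sum_distrib_left mult.assoc)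
  also have "\<dots> = (\<Sum>i\<in>{0..int d * a}. of_int a * Phi e (a, i) x * log_kernel \<rho> l b i x)"
    unfolding sum_distrib_right[symmetric] Phi_homogeneous ..
  finally show ?thesis
    using a by (simp add: psi_family_def psi_nonneg_eq_sum[where e=e, OF e_le] sum_distrib_left mult.assoc)
qed

text \<open>
  For \<open>a > 0\<close>, the factor \<open>i\<close> produced by the weighted homogeneity of \<open>Phi\<close> is split as \<open>b + (i - b)\<close>.  The second
  part cancels the denominator of the kernel and would give \<open>\<rho>^(-b) f(x;\<rho>)^a / a! = 0\<close>, but the
  logarithmic term has no denominator to cancel; its absence is the defect \<open>- Phi\<close>.
\<close>

lemma euler_2_nonneg:
  assumes x: "x \<in> U" and a: "a \<ge> 0"
  shows "(\<Sum>j\<in>UNIV. of_nat (e j) * x $ j * fam (a - 1) (b - int (e j)) x) =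
    of_int b * fam a b x - Phi e (a, b) x"
proof (cases "a = 0")
  case True
  have "(\<Sum>j\<in>UNIV. of_nat (e j) * x $ j * fam (a - 1) (b - int (e j)) x) =
      (\<Sum>j\<in>UNIV. of_nat (e j) * x $ j * (\<rho> x powi (- b - 1) * R x j))"
    using True psi_neg_1[OF x] by (simp add: psi_family_def)
  also have "\<dots> = - (\<rho> x powi (- b - 1) / poly (pderiv (f_poly e x)) (\<rho> x)) *
      (\<rho> x * poly (pderiv (f_poly e x)) (\<rho> x))"
    unfolding poly_pderiv_f_poly
    by (simp add: root_implicit_derivative[OF x] sum_distrib_left sum_negf sum_divide_distrib mult_ac)
  also have "\<dots> = - (\<rho> x powi (- b))"
    using simple_root[OF x] root_nonzero[OF x] by (simp add: power_int_diff)
  finally show ?thesis using True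
    by (auto simp: psi_family_def psi_nonneg_eq_sum[where e=e, OF e_le] Phi_zero log_kernel_def)
next
  case False
  have "(\<Sum>j\<in>UNIV. of_nat (e j) * x $ j * fam (a - 1) (b - int (e j)) x) =
      (\<Sum>j\<in>UNIV. of_nat (e j) * x $ j * (\<Sum>i\<in>{0..int d * a}. Phi e (a - 1, i - int (e j)) x * log_kernel \<rho> l b i x))"
    unfolding Phi_sum_shift[where e=e, OF e_le] log_kernel_shift
    using False a by (simp add: psi_family_def psi_nonneg_eq_sum[where e=e, OF e_le])
  also have "\<dots> = (\<Sum>i\<in>{0..int d * a}. \<Sum>j\<in>UNIV. of_nat (e j) * x $ j * Phi e (a - 1, i - int (e j)) x * log_kernel \<rho> l b i x)"
    by (subst sum.swap) (simp add: sum_distrib_left mult.assoc)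
  also have "\<dots> = (\<Sum>i\<in>{0..int d * a}. of_int i * Phi e (a, i) x * log_kernel \<rho> l b i x)"
    unfolding sum_distrib_right[symmetric] Phi_weighted_homogeneous ..
  also have "\<dots> = (\<Sum>i\<in>{0..int d * a}. of_int b * (Phi e (a, i) x * log_kernel \<rho> l b i x)
      + \<rho> x powi (- b) * (Phi e (a, i) x * \<rho> x powi i) - (if i = b then Phi e (a, i) x else 0))"
  proof (rule sum.cong[OF refl])
    fix i
    have "of_int i * log_kernel \<rho> l b i x =
        of_int b * log_kernel \<rho> l b i x + \<rho> x powi (- b) * \<rho> x powi i - (if i = b then 1 else 0)"
    proof (cases "i = b")
      case True
      then show ?thesis using root_nonzero[OF x] by (simp add: power_int_add[symmetric])
    next
      case False
      have "\<rho> x powi (- b) * \<rho> x powi i = \<rho> x powi (i - b)"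
        using root_nonzero[OF x] by (simp add: power_int_add[symmetric])
      moreover have "of_int i - of_int b \<noteq> (0::complex)" using False by simp
      ultimately show ?thesis using False by (simp add: log_kernel_def divide_simps) (simp add: algebra_simps)
    qed
    then have "Phi e (a, i) x * (of_int i * log_kernel \<rho> l b i x) =
        Phi e (a, i) x * (of_int b * log_kernel \<rho> l b i x + \<rho> x powi (- b) * \<rho> x powi i - (if i = b then 1 else 0))"
      by simp
    then show "of_int i * Phi e (a, i) x * log_kernel \<rho> l b i x =
        of_int b * (Phi e (a, i) x * log_kernel \<rho> l b i x)
      + \<rho> x powi (- b) * (Phi e (a, i) x * \<rho> x powi i) - (if i = b then Phi e (a, i) x else 0)"
      by (simp add: algebra_simps split: if_splits)
  qed
  also have "\<dots> = of_int b * fam a b x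
      + \<rho> x powi (- b) * (\<Sum>i\<in>{0..int d * a}. Phi e (a, i) x * \<rho> x powi i)
      - (\<Sum>i\<in>{0..int d * a}. if i = b then Phi e (a, i) x else 0)"
    using a by (simp add: psi_family_def psi_nonneg_eq_sum[where e=e, OF e_le] sum.distrib sum_subtractf sum_distrib_left)
  also have "(\<Sum>i\<in>{0..int d * a}. Phi e (a, i) x * \<rho> x powi i) = 0"
    using False a by (intro Phi_sum_at_root[where e=e, OF e_le root[OF x] root_nonzero[OF x]]) simp
  also have "(\<Sum>i\<in>{0..int d * a}. if i = b then Phi e (a, i) x else 0) = Phi e (a, b) x"
  proof (cases "b \<in> {0..int d * a}")
    case True
    then show ?thesis by simp
  next
    case False
    then have "(a, b) \<notin> I_A e" using I_A_bounds[of a b e d] e_le by auto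
    with False show ?thesis by (simp add: Phi_notin_I_A)
  qed
  finally show ?thesis by simp
qed

text \<open>
  For negative \<open>a\<close> the equations descend from those for \<open>a + 1\<close>: the derivative of the equation for
  \<open>(a + 1, b + e i)\<close> with respect to \<open>x_i\<close> is the equation for \<open>(a, b)\<close>.
\<close>

lemma euler_1_2:
  assumes "x \<in> U"
  shows "(\<Sum>j\<in>UNIV. x $ j * fam (a - 1) (b - int (e j)) x) = of_int a * fam a b x \<and>
    (\<Sum>j\<in>UNIV. of_nat (e j) * x $ j * fam (a - 1) (b - int (e j)) x) =
      of_int b * fam a b x - Phi e (a, b) x"
proof (cases "a \<ge> 0")
  case True
  then show ?thesis using euler_1_nonneg euler_2_nonneg assms by blast
next
  case False
  \<comment> \<open>The choice of the variable does not matter, since the equations of the next higher order hold at every \<open>b\<close>.\<close>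
  define i0 where "i0 = (undefined :: 'n)"
  have "\<forall>x\<in>U. \<forall>b. (\<Sum>j\<in>UNIV. x $ j * fam (- int n - 1) (b - int (e j)) x) = of_int (- int n) * fam (- int n) b x \<and>
    (\<Sum>j\<in>UNIV. of_nat (e j) * x $ j * fam (- int n - 1) (b - int (e j)) x) =
      of_int b * fam (- int n) b x - Phi e (- int n, b) x" for n
  proof (induction n)
    case 0
    then show ?case using euler_1_nonneg[of _ 0] euler_2_nonneg[of _ 0] by simp
  next
    case (Suc n)
    define a where "a = - int n"
    have Sa: "- int (Suc n) = a - 1" by (simp add: a_def)
    note IH = Suc[folded a_def]
    show ?case unfolding Sa
    proof (intro ballI allI)
      fix x b assume x: "x \<in> U"
      define b0 where "b0 = b + int (e i0)"
      have b: "b = b0 - int (e i0)" by (simp add: b0_def)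
      let ?c1 = "\<Sum>j\<in>UNIV. x $ j * fam (a - 1 - 1) (b - int (e j)) x"
      let ?c2 = "\<Sum>j\<in>UNIV. of_nat (e j) * x $ j * fam (a - 1 - 1) (b - int (e j)) x"
      have comm: "b0 - int (e j) - int (e i0) = b - int (e j)" for j by (simp add: b0_def)
      have "has_partials (\<lambda>y. \<Sum>j\<in>UNIV. y $ j * fam (a - 1) (b0 - int (e j)) y)
         (\<lambda>i. \<Sum>j\<in>UNIV. (if i = j then 1 else 0) * fam (a - 1) (b0 - int (e j)) x
            + x $ j * fam (a - 1 - 1) (b0 - int (e j) - int (e i)) x) x"
        by (intro has_partials_sum has_partials_mult has_partials_coord has_partials_psi_family x)
      then have "has_partials (\<lambda>y. of_int a * fam a b0 y)
         (\<lambda>i. \<Sum>j\<in>UNIV. (if i = j then 1 else 0) * fam (a - 1) (b0 - int (e j)) x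
            + x $ j * fam (a - 1 - 1) (b0 - int (e j) - int (e i)) x) x"
        by (rule has_partials_transform[OF _ open_U x]) (use IH in blast)
      moreover have "has_partials (\<lambda>y. of_int a * fam a b0 y)
         (\<lambda>i. of_int a * fam (a - 1) (b0 - int (e i)) x) x"
        by (intro has_partials_cmult has_partials_psi_family x)
      ultimately have "(\<lambda>i. \<Sum>j\<in>UNIV. (if i = j then 1 else 0) * fam (a - 1) (b0 - int (e j)) x
            + x $ j * fam (a - 1 - 1) (b0 - int (e j) - int (e i)) x) =
          (\<lambda>i. of_int a * fam (a - 1) (b0 - int (e i)) x)"
        by (rule has_partials_unique)
      from fun_cong[OF this, of i0]
      have "fam (a - 1) b x + ?c1 = of_int a * fam (a - 1) b x"
        by (simp add: sum.distrib comm b[symmetric] if_distrib[of "\<lambda>z. z * _"] cong: if_cong)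
      then have 1: "?c1 = of_int (a - 1) * fam (a - 1) b x" by (simp add: algebra_simps)
      have "has_partials (\<lambda>y. \<Sum>j\<in>UNIV. of_nat (e j) * (y $ j * fam (a - 1) (b0 - int (e j)) y))
         (\<lambda>i. \<Sum>j\<in>UNIV. of_nat (e j) * ((if i = j then 1 else 0) * fam (a - 1) (b0 - int (e j)) x
            + x $ j * fam (a - 1 - 1) (b0 - int (e j) - int (e i)) x)) x"
        by (intro has_partials_sum has_partials_mult has_partials_cmult has_partials_coord
            has_partials_psi_family x)
      then have "has_partials (\<lambda>y. of_int b0 * fam a b0 y + (-1) * Phi e (a, b0) y)
         (\<lambda>i. \<Sum>j\<in>UNIV. of_nat (e j) * ((if i = j then 1 else 0) * fam (a - 1) (b0 - int (e j)) x
            + x $ j * fam (a - 1 - 1) (b0 - int (e j) - int (e i)) x)) x"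
        by (rule has_partials_transform[OF _ open_U x]) (use IH in \<open>simp add: mult.assoc\<close>)
      moreover have "has_partials (\<lambda>y. of_int b0 * fam a b0 y + (-1) * Phi e (a, b0) y)
         (\<lambda>i. of_int b0 * fam (a - 1) (b0 - int (e i)) x + (-1) * Phi e (a - 1, b0 - int (e i)) x) x"
        by (intro has_partials_add has_partials_cmult has_partials_psi_family has_partials_Phi x)
      ultimately have "(\<lambda>i. \<Sum>j\<in>UNIV. of_nat (e j) * ((if i = j then 1 else 0) * fam (a - 1) (b0 - int (e j)) x
            + x $ j * fam (a - 1 - 1) (b0 - int (e j) - int (e i)) x)) =
          (\<lambda>i. of_int b0 * fam (a - 1) (b0 - int (e i)) x + (-1) * Phi e (a - 1, b0 - int (e i)) x)"
        by (rule has_partials_unique)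
      from fun_cong[OF this, of i0]
      have "of_nat (e i0) * fam (a - 1) b x + ?c2 =
          of_int b0 * fam (a - 1) b x - Phi e (a - 1, b) x"
        by (simp add: sum.distrib distrib_left comm b[symmetric] mult.assoc
            if_distrib[of "\<lambda>z. z * _"] if_distrib[of "\<lambda>z. _ * z"] cong: if_cong)
      then have 2: "?c2 = of_int b * fam (a - 1) b x - Phi e (a - 1, b) x"
        by (simp add: b0_def algebra_simps)
      from 1 2 show "?c1 = of_int (a - 1) * fam (a - 1) b x \<and>
          ?c2 = of_int b * fam (a - 1) b x - Phi e (a - 1, b) x" ..
    qed
  qed
  from this[of "nat (- a)"] False assms show ?thesis by simp
qed

section \<open>Iterated derivatives and the hypergeometric system\<close>

lemma partial_iterate_family:
  assumes "\<And>y. y \<in> U \<Longrightarrow> h y = fam a b y" and "x \<in> U"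
  shows "(partial i ^^ n) h x = fam (a - int n) (b - int (e i) * int n) x"
  using assms(2)
proof (induction n arbitrary: x)
  case 0
  then show ?case using assms(1) by simp
next
  case (Suc n)
  have "has_partials (fam (a - int n) (b - int (e i) * int n))
     (\<lambda>j. fam (a - int n - 1) (b - int (e i) * int n - int (e j)) x) x"
    by (rule has_partials_psi_family[OF Suc.prems])
  then have "has_partials ((partial i ^^ n) h)
     (\<lambda>j. fam (a - int n - 1) (b - int (e i) * int n - int (e j)) x) x"
    by (rule has_partials_transform[OF _ open_U Suc.prems]) (simp add: Suc.IH)
  from has_partials_partial[OF this, of i] show ?case
    by (simp add: algebra_simps)
qed

lemma foldr_partial_family:
  assumes "distinct is" "\<And>y. y \<in> U \<Longrightarrow> g y = fam a b y" "x \<in> U"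
  shows "foldr (\<lambda>i h. (partial i ^^ u i) h) is g x =
    fam (a - (\<Sum>i\<in>set is. int (u i))) (b - (\<Sum>i\<in>set is. int (e i) * int (u i))) x"
  using assms(1,3)
proof (induction "is" arbitrary: x)
  case Nil
  then show ?case using assms(2) by simp
next
  case (Cons i js)
  have "(partial i ^^ u i) (foldr (\<lambda>i h. (partial i ^^ u i) h) js g) x =
      fam (a - (\<Sum>i\<in>set js. int (u i)) - int (u i))
        (b - (\<Sum>i\<in>set js. int (e i) * int (u i)) - int (e i) * int (u i)) x"
    using Cons by (intro partial_iterate_family) auto
  then show ?case using Cons.prems by (simp add: algebra_simps)
qed

lemma D_op_family:
  assumes "inj e" "\<And>y. y \<in> U \<Longrightarrow> g y = psi_family e d \<rho> l \<beta> y" "x \<in> U"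
  shows "D_op e u g x = psi_family e d \<rho> l (\<beta> - A_nmult e u) x"
proof -
  obtain a b where "\<beta> = (a, b)" by (cases \<beta>)
  then show ?thesis
    unfolding D_op_def
    using foldr_partial_family[of "sorted_key_list_of_set e UNIV" g a b x u] assms(2,3)
    by (simp add: A_mult_def sorted_key_list_of_finite_type[OF assms(1)])
qed

text \<open>
  For negative \<open>a\<close> the derivative \<open>D_u\<close> brings the exponent \<open>\<alpha> + \<A> u\<close> back to \<open>\<alpha>\<close>, whatever admissible
  \<open>u\<close> has been selected.
\<close>

lemma psi_eq_family:
  assumes inj: "inj e" and x: "x \<in> U"
  shows "psi e d \<rho> l \<alpha> x = psi_family e d \<rho> l \<alpha> x"
proof (cases "fst \<alpha> \<ge> 0")
  case True
  then show ?thesis by (simp add: psi_def psi_family_def)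
next
  case False
  define u where "u = (SOME u. fst (A_nmult e u) \<ge> - fst \<alpha>)"
  have "\<exists>u. fst (A_nmult e u) \<ge> - fst \<alpha>"
  proof
    have "int (nat (- fst \<alpha>)) \<le> (\<Sum>i\<in>(UNIV::'n set). int (nat (- fst \<alpha>)))"
      by (rule member_le_sum) auto
    then show "fst (A_nmult e (\<lambda>i. nat (- fst \<alpha>))) \<ge> - fst \<alpha>"
      using False by (simp add: A_mult_def)
  qed
  then have u: "fst (A_nmult e u) \<ge> - fst \<alpha>" unfolding u_def by (rule someI_ex)
  have "psi e d \<rho> l \<alpha> x = D_op e u (psi_nonneg e d \<rho> l (\<alpha> + A_nmult e u)) x"
    using False by (simp add: psi_def u_def Let_def)
  also have "\<dots> = psi_family e d \<rho> l (\<alpha> + A_nmult e u - A_nmult e u) x"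
    using u by (intro D_op_family inj x) (simp add: psi_family_def)
  finally show ?thesis by simp
qed

text \<open>
  In a toric equation both operators subtract the same vector from the exponent.
\<close>

lemma A_hypergeometric_psi:
  assumes inj: "inj e" and \<alpha>: "\<alpha> \<notin> I_A e"
  shows "A_hypergeometric e \<alpha> U (psi e d \<rho> l \<alpha>)"
proof -
  obtain a b where ab: "\<alpha> = (a, b)" by (cases \<alpha>)
  have eq: "psi e d \<rho> l \<alpha> y = fam a b y" if "y \<in> U" for y
    using psi_eq_family[OF inj that] by (simp add: ab)
  have part: "has_partials (psi e d \<rho> l \<alpha>) (\<lambda>i. fam (a - 1) (b - int (e i)) x) x" if "x \<in> U" for x
    by (rule has_partials_transform[OF has_partials_psi_family[OF that] open_U that]) (simp add: eq)
  have toric: "D_op e (\<lambda>i. nat (v i)) (psi e d \<rho> l \<alpha>) x = D_op e (\<lambda>i. nat (- v i)) (psi e d \<rho> l \<alpha>) x"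
    if v: "A_mult e v = (0, 0)" and x: "x \<in> U" for v x
  proof -
    have "(\<Sum>i\<in>UNIV. int (nat (v i)) - int (nat (- v i))) = 0"
      "(\<Sum>i\<in>UNIV. int (e i) * (int (nat (v i)) - int (nat (- v i)))) = 0"
    proof -
      have "int (nat z) - int (nat (- z)) = z" for z by simp
      then show "(\<Sum>i\<in>UNIV. int (nat (v i)) - int (nat (- v i))) = 0"
        "(\<Sum>i\<in>UNIV. int (e i) * (int (nat (v i)) - int (nat (- v i)))) = 0"
        using v by (simp_all only: A_mult_def prod.inject)
    qed
    then have "A_nmult e (\<lambda>i. nat (v i)) = A_nmult e (\<lambda>i. nat (- v i))"
      by (simp add: A_mult_def sum_subtractf right_diff_distrib)
    then show ?thesis
      using D_op_family[OF inj, of "psi e d \<rho> l \<alpha>" \<alpha> x] x psi_eq_family[OF inj] by simp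
  qed
  have "(\<Sum>i\<in>UNIV. x $ i * partial i (psi e d \<rho> l \<alpha>) x) = of_int (fst \<alpha>) * psi e d \<rho> l \<alpha> x"
    "(\<Sum>i\<in>UNIV. of_nat (e i) * x $ i * partial i (psi e d \<rho> l \<alpha>) x) = of_int (snd \<alpha>) * psi e d \<rho> l \<alpha> x"
    if x: "x \<in> U" for x
    using euler_1_2[OF x, of a b] Phi_notin_I_A[OF \<alpha>, unfolded ab]
    unfolding has_partials_partial[OF part[OF x]] eq[OF x] by (simp_all add: ab)
  then show ?thesis
    unfolding A_hypergeometric_def
    using toric has_partials_imp_mholomorphic[OF part] by blast
qed

end

section \<open>Lattice points deep inside the cone\<close>

lemma Gcd_eq_int_combination:
  fixes e :: "'n::finite \<Rightarrow> nat"
  assumes "finite A" "A \<subseteq> range e"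
  shows "\<exists>v. (\<Sum>i\<in>UNIV. int (e i) * v i) = int (Gcd A)"
  using assms
proof (induction A rule: finite_induct)
  case empty
  then show ?case by (intro exI[of _ "\<lambda>i. 0"]) simp
next
  case (insert y A)
  then obtain v where v: "(\<Sum>i\<in>UNIV. int (e i) * v i) = int (Gcd A)" by auto
  obtain i0 where i0: "y = e i0" using insert.prems by auto
  obtain s t where st: "s * int y + t * int (Gcd A) = gcd (int y) (int (Gcd A))"
    using bezout_int by blast
  have "(\<Sum>i\<in>UNIV. int (e i) * (s * (if i = i0 then 1 else 0) + t * v i)) =
      s * (\<Sum>i\<in>UNIV. int (e i) * (if i = i0 then 1 else 0)) + t * (\<Sum>i\<in>UNIV. int (e i) * v i)"
    by (simp add: algebra_simps sum.distrib sum_distrib_left)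
  also have "(\<Sum>i\<in>UNIV. int (e i) * (if i = i0 then 1 else 0)) = int y"
    by (simp add: i0 if_distrib[of "\<lambda>z. _ * z"] cong: if_cong)
  also have "s * int y + t * (\<Sum>i\<in>UNIV. int (e i) * v i) = int (Gcd (insert y A))"
    using st v by (simp add: gcd_int_int_eq)
  finally show ?case
    by (intro exI[of _ "\<lambda>i. s * (if i = i0 then 1 else 0) + t * v i"])
qed

text \<open>
  By Bezout some nonnegative combination of the columns, with coefficients below \<open>d\<close>, has a second
  coordinate congruent to \<open>q\<close> modulo \<open>d\<close>.  Adding the column \<open>(1, d)\<close> corrects the second coordinate,
  and the column \<open>(1, 0)\<close> then fills up the first; the two bounds on \<open>q\<close> leave room for this.
\<close>

lemma I_A_contains_cone_interior:
  fixes e :: "'n::finite \<Rightarrow> nat"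
  assumes gcd: "Gcd (range e) = 1" and i0: "e i0 = 0" and i1: "e i1 = d" and d: "d > 0"
    and le: "\<And>i. e i \<le> d"
    and q: "int (d * (d * CARD('n))) \<le> q" "q \<le> int d * (n - int (d * CARD('n)))"
  shows "(n, q) \<in> I_A e"
proof -
  obtain v where v: "(\<Sum>i\<in>UNIV. int (e i) * v i) = 1"
    using Gcd_eq_int_combination[of "range e" e] gcd by auto
  \<comment> \<open>Reducing the Bezout coefficients modulo \<open>d\<close> makes them nonnegative and bounded.\<close>
  define w where "w = (\<lambda>i. nat ((q * v i) mod int d))"
  have wi: "int (w i) = (q * v i) mod int d" for i using d by (simp add: w_def)
  have w_le: "int (w i) \<le> int d" for i unfolding wi using d by (simp add: less_imp_le)
  define W where "W = (\<Sum>i\<in>UNIV. int (w i))"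
  define s where "s = (\<Sum>i\<in>UNIV. int (e i) * int (w i))"
  have W: "W \<le> int (d * CARD('n))"
    unfolding W_def using sum_bounded_above[of UNIV "\<lambda>i. int (w i)" "int d"] w_le by (simp add: mult.commute)
  have "s \<le> int d * W"
    unfolding s_def W_def sum_distrib_left using le by (intro sum_mono mult_right_mono) auto
  also have "\<dots> \<le> int d * int (d * CARD('n))" using W by (intro mult_left_mono) auto
  finally have s: "s \<le> q" using q(1) by simp
  have "q - s = (\<Sum>i\<in>UNIV. int (e i) * (q * v i - (q * v i) mod int d))"
  proof -
    have "q = (\<Sum>i\<in>UNIV. int (e i) * (q * v i))"
      using v by (simp add: sum_distrib_left[symmetric] mult.left_commute)
    then show ?thesis unfolding s_def wi by (simp add: right_diff_distrib sum_subtractf)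
  qed
  also have "int d dvd \<dots>"
    by (intro dvd_sum dvd_mult) (simp add: minus_mod_eq_mult_div)
  finally obtain l where l: "q - s = int d * l" by (auto elim: dvdE)
  have "int d * l \<ge> 0" using l s by simp
  then have l0: "l \<ge> 0" using d by (simp add: zero_le_mult_iff)
  have "s \<ge> 0" unfolding s_def by (intro sum_nonneg) auto
  then have "int d * l \<le> int d * (n - int (d * CARD('n)))" using l q(2) by linarith
  then have "l \<le> n - int (d * CARD('n))" using d by simp
  then have r0: "n - W - l \<ge> 0" using W by linarith
  define u where "u = (\<lambda>i. w i + (if i = i1 then nat l else 0) + (if i = i0 then nat (n - W - l) else 0))"
  have u: "int (u i) = int (w i) + (if i = i1 then l else 0) + (if i = i0 then n - W - l else 0)" for i
    using l0 r0 by (simp add: u_def)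
  have "(\<Sum>i\<in>UNIV. int (u i)) = n"
    by (simp add: u sum.distrib W_def[symmetric])
  moreover have "(\<Sum>i\<in>UNIV. int (e i) * int (u i)) = q"
    using l by (simp add: u distrib_left sum.distrib s_def[symmetric] if_distrib[of "\<lambda>z. _ * z"] i0 i1
        cong: if_cong)
  ultimately have "A_nmult e u = (n, q)" by (simp add: A_mult_def)
  then show ?thesis unfolding I_A_def by (metis rangeI)
qed

section \<open>A test polynomial separating two roots\<close>

lemma taylor_shift_monom_1: "taylor_shift r (monom 1 p) = (fps_const r + fps_X) ^ p"
  by (simp add: taylor_shift_monom)

lemma taylor_powi_of_nat: "r \<noteq> 0 \<Longrightarrow> taylor_powi r (int p) = taylor_shift r (monom 1 p)"
  using taylor_powi_mult_power[of r 0 p] by (simp add: taylor_powi_0 taylor_shift_monom_1)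

lemma fps_linear_power_nth_0:
  fixes r :: complex
  assumes "p < m"
  shows "fps_nth ((fps_const r + fps_X) ^ p) m = 0"
proof -
  have "(fps_const r + fps_X) ^ p = fps_of_poly ([:r, 1:] ^ p)"
    by (simp add: fps_of_poly_power fps_of_poly_linear add.commute)
  then have "fps_nth ((fps_const r + fps_X) ^ p) m = coeff ([:r, 1:] ^ p) m"
    by (simp only: fps_of_poly_nth)
  also have "\<dots> = 0" using assms by (intro coeff_eq_0) (simp only: degree_linear_power)
  finally show ?thesis .
qed

lemma fps_inverse_linear_nth:
  fixes t :: complex
  assumes "t \<noteq> 0"
  shows "fps_nth (inverse (fps_const t + fps_X)) m = (-1) ^ m / t ^ Suc m"
proof -
  define h where "h = Abs_fps (\<lambda>m. (-1) ^ m / t ^ Suc m)"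
  have "(fps_const t + fps_X) * h = 1"
  proof (rule fps_ext)
    fix k show "fps_nth ((fps_const t + fps_X) * h) k = fps_nth 1 k"
      using assms by (cases k) (simp_all add: h_def distrib_right field_simps)
  qed
  then have "inverse (fps_const t + fps_X) = h" by (rule fps_inverse_unique)
  then show ?thesis by (simp add: h_def)
qed

text \<open>
  Modulo \<open>t + X\<close> the numerator is the constant \<open>s^p\<close>, and the quotient is a polynomial of degree less
  than \<open>p\<close>, which does not reach the coefficient of \<open>X^m\<close>.
\<close>

lemma linear_power_over_linear_nth:
  fixes s t :: complex
  assumes "t \<noteq> 0" "p \<le> m"
  shows "fps_nth ((fps_const (t + s) + fps_X) ^ p * inverse (fps_const t + fps_X)) m =
    s ^ p * ((-1) ^ m / t ^ Suc m)"
  using assms(2)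
proof (induction p)
  case 0
  then show ?case using fps_inverse_linear_nth[OF assms(1)] by simp
next
  case (Suc p)
  let ?L = "fps_const (t + s) + fps_X" and ?M = "fps_const t + fps_X :: complex fps"
  have LM: "?L = fps_const s + ?M" by (simp add: fps_const_add[symmetric] del: fps_const_add)
  have "?M * inverse ?M = 1" using assms(1) by (intro inverse_mult_eq_1') simp
  moreover have "A * B * I = S * (B * I) + B * (M * I)" if "A = S + M" for A B I S M :: "complex fps"
    unfolding that by (simp add: algebra_simps)
  from this[OF LM] have "?L ^ Suc p * I = fps_const s * (?L ^ p * I) + ?L ^ p * (?M * I)" for I
    unfolding power_Suc .
  ultimately have "?L ^ Suc p * inverse ?M = fps_const s * (?L ^ p * inverse ?M) + ?L ^ p"
    by simp
  then show ?case using Suc by (simp add: fps_linear_power_nth_0)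
qed

lemma poly_eq_prod_roots:
  fixes f :: "complex poly"
  assumes "finite J" "inj_on r J" "card J = degree f" "\<And>k. k \<in> J \<Longrightarrow> poly f (r k) = 0"
  shows "f = Polynomial.smult (lead_coeff f) (\<Prod>k\<in>J. [:- r k, 1:])"
proof (rule poly_eqI_degree_lead_coeff[where n = "degree f" and A = "r ` J"])
  have deg: "degree (\<Prod>k\<in>J. [:- r k, 1:]) = degree f"
    using assms(3) by (subst degree_prod_eq_sum_degree) auto
  have lc: "lead_coeff (\<Prod>k\<in>J. [:- r k, 1:]) = 1"
    by (simp add: lead_coeff_prod)
  show "coeff f (degree f) = coeff (Polynomial.smult (lead_coeff f) (\<Prod>k\<in>J. [:- r k, 1:])) (degree f)"
    using lc deg by simp
  show "degree f \<le> card (r ` J)" using assms by (simp add: card_image)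
  show "degree (Polynomial.smult (lead_coeff f) (\<Prod>k\<in>J. [:- r k, 1:])) \<le> degree f"
    using deg by (metis degree_smult_le)
  fix z assume "z \<in> r ` J"
  then show "poly f z = poly (Polynomial.smult (lead_coeff f) (\<Prod>k\<in>J. [:- r k, 1:])) z"
    using assms by (auto simp: poly_prod)
qed simp

lemma fps_nth_0_prod: "fps_nth (\<Prod>k\<in>A. F k :: 'a::comm_ring_1 fps) 0 = (\<Prod>k\<in>A. fps_nth (F k) 0)"
  by (induction A rule: infinite_finite_induct) auto

lemma root_cofactor_prod:
  assumes f: "f = Polynomial.smult c (\<Prod>k\<in>J. [:- r k, 1:])" and "finite J" "j \<in> J"
  shows "fps_shift 1 (taylor_shift (r j) f) =
    fps_const c * (\<Prod>k\<in>J - {j}. fps_const (r j - r k) + fps_X)"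
proof -
  have "f = [:c:] * (\<Prod>k\<in>J. [:- r k, 1:])" using f by simp
  then have "taylor_shift (r j) f = fps_const c * (\<Prod>k\<in>J. fps_const (r j - r k) + fps_X)"
    by (simp only: taylor_shift_mult taylor_shift_prod taylor_shift_const taylor_shift_linear)
  also have "(\<Prod>k\<in>J. fps_const (r j - r k) + fps_X) =
      fps_X * (\<Prod>k\<in>J - {j}. fps_const (r j - r k) + fps_X)"
    using assms by (subst prod.remove[of J j]) auto
  finally have "taylor_shift (r j) f =
      (fps_const c * (\<Prod>k\<in>J - {j}. fps_const (r j - r k) + fps_X)) * fps_X"
    by (simp only: mult_ac)
  then show ?thesis by (simp only: fps_shift_times_fps_X')
qed

text \<open>
  The numerator that cancels all poles of \<open>1 / f^n\<close> except the one at \<open>r a\<close>, which stays of order \<open>n\<close>,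
  and a simple one at \<open>r b\<close>.
\<close>

definition separating_poly :: "(nat \<Rightarrow> complex) \<Rightarrow> nat set \<Rightarrow> nat \<Rightarrow> nat \<Rightarrow> nat \<Rightarrow> complex poly" where
  "separating_poly r J a b n = (\<Prod>k\<in>J - {a, b}. [:- r k, 1:] ^ n) * [:- r b, 1:] ^ (n - 1)"

lemma degree_separating_poly:
  assumes "finite J" "a \<in> J" "b \<in> J" "a \<noteq> b" "n > 0"
  shows "degree (separating_poly r J a b n) + n + 1 = card J * n"
proof -
  have "degree (separating_poly r J a b n) = card (J - {a, b}) * n + (n - 1)"
    unfolding separating_poly_def
    by (subst degree_mult_eq) (auto simp: degree_prod_eq_sum_degree degree_linear_power assms)
  moreover have "card J = card (J - {a, b}) + 2"
  proof -
    have "card {a, b} \<le> card J" using assms by (intro card_mono) auto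
    then show ?thesis using assms by (simp add: card_Diff_subset)
  qed
  ultimately show ?thesis using assms(5) by simp
qed

text \<open>
  Cancelling the separating polynomial leaves \<open>t^p / (c^n (t - r a)^n (t - r b))\<close>.  Its residues at
  \<open>r a\<close> and \<open>r b\<close> are opposite and nonzero, so the relation says that the weights agree.
\<close>

lemma weights_equal_of_residue_relation:
  fixes r w :: "nat \<Rightarrow> complex"
  assumes J: "finite J" "a \<in> J" "b \<in> J" "a \<noteq> b" and inj: "inj_on r J" and rb: "r b \<noteq> 0"
    and c: "c \<noteq> 0" and f: "f = Polynomial.smult c (\<Prod>k\<in>J. [:- r k, 1:])"
    and pn: "p < n"
    and rel: "(\<Sum>j\<in>J. w j * fps_nth (taylor_shift (r j) (monom 1 p * separating_poly r J a b n) *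
        inverse (fps_shift 1 (taylor_shift (r j) f)) ^ n) (n - 1)) = 0"
  shows "w a = w b"
proof -
  define V where "V = (\<lambda>j. inverse (fps_shift 1 (taylor_shift (r j) f)))"
  define M where "M = (\<lambda>j k. fps_const (r j - r k) + fps_X)"
  define P where "P = (\<lambda>j. \<Prod>k\<in>J - {a, b}. M j k)"
  define L where "L = (\<lambda>j. fps_const (r j) + fps_X)"
  define t where "t = (\<lambda>j. fps_nth (L j ^ p * (P j ^ n * M j b ^ (n - 1)) * V j ^ n) (n - 1))"
  have rel': "(\<Sum>j\<in>J. w j * t j) = 0"
    using rel unfolding t_def separating_poly_def V_def
    by (simp only: taylor_shift_mult taylor_shift_prod taylor_shift_power taylor_shift_linear
        taylor_shift_monom_1 M_def P_def L_def prod_power_distrib)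
  have neq: "r j - r k \<noteq> 0" if "j \<in> J" "k \<in> J" "j \<noteq> k" for j k
    using inj that by (auto simp: inj_on_def)
  have gV: "(fps_const c * (\<Prod>k\<in>J - {j}. M j k)) * V j = 1" if "j \<in> J" for j
  proof -
    have "fps_nth (fps_const c * (\<Prod>k\<in>J - {j}. M j k)) 0 \<noteq> 0"
      using c J(1) that neq by (simp add: fps_nth_0_prod M_def)
    then show ?thesis
      unfolding V_def root_cofactor_prod[OF f J(1) that] M_def by (rule inverse_mult_eq_1')
  qed
  have split: "(\<Prod>k\<in>J - {i}. M i k) = P i * M i j" if "i = a \<and> j = b \<or> i = b \<and> j = a" for i j
  proof -
    have "J - {i} = insert j (J - {a, b})" using that J(2-4) by blast
    moreover have "j \<notin> J - {a, b}" using that by blast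
    ultimately show ?thesis unfolding P_def using J(1) by (simp add: mult.commute)
  qed
  \<comment> \<open>At the other roots the numerator vanishes to the order \<open>n\<close> of the pole.\<close>
  have t0: "t j = 0" if "j \<in> J - {a, b}" for j
  proof -
    have "P j = fps_X * (\<Prod>k\<in>J - {a, b} - {j}. M j k)"
      unfolding P_def using J(1) that by (subst prod.remove[of _ j]) (auto simp: M_def)
    then have "L j ^ p * (P j ^ n * M j b ^ (n - 1)) * V j ^ n =
        fps_X ^ n * (L j ^ p * ((\<Prod>k\<in>J - {a, b} - {j}. M j k) ^ n * M j b ^ (n - 1)) * V j ^ n)"
      by (simp add: power_mult_distrib mult_ac)
    then show ?thesis unfolding t_def using pn by (simp only: fps_X_power_mult_nth) simp
  qed
  define s where "s = r a - r b"
  have s: "s \<noteq> 0" using neq J by (simp add: s_def)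
  have ta: "c ^ n * t a = r b ^ p * ((-1) ^ (n - 1) / s ^ n)"
  proof -
    have g: "(fps_const c * (P a * M a b)) * V a = 1"
      using gV[OF J(2)] split[of a b] J by simp
    have Mi: "M a b * inverse (M a b) = 1"
      using s by (intro inverse_mult_eq_1') (simp add: M_def s_def)
    have n: "M a b ^ n = M a b ^ (n - 1) * M a b"
      using pn by (cases n) (simp_all add: mult.commute)
    have "fps_const (c ^ n) * (L a ^ p * (P a ^ n * M a b ^ (n - 1)) * V a ^ n) =
        fps_const (c ^ n) * (L a ^ p * (P a ^ n * M a b ^ (n - 1)) * V a ^ n) * (M a b * inverse (M a b))"
      by (simp only: Mi mult_1_right)
    also have "\<dots> = L a ^ p * ((fps_const c * (P a * M a b)) * V a) ^ n * inverse (M a b)"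
      unfolding power_mult_distrib n fps_const_power[symmetric] by (simp only: mult_ac)
    also have "\<dots> = L a ^ p * inverse (M a b)" unfolding g by simp
    finally have "c ^ n * t a = fps_nth (L a ^ p * inverse (M a b)) (n - 1)"
      unfolding t_def by (metis fps_mult_left_const_nth)
    also have "\<dots> = r b ^ p * ((-1) ^ (n - 1) / s ^ Suc (n - 1))"
      using linear_power_over_linear_nth[OF s, of p "n - 1" "r b"] pn by (simp add: L_def M_def s_def)
    finally show ?thesis using pn by simp
  qed
  have tb: "c ^ n * t b = r b ^ p / (- s) ^ n"
  proof -
    have g: "(fps_const c * (P b * M b a)) * V b = 1"
      using gV[OF J(3)] split[of b a] J by simp
    define S where "S = L b ^ p * P b ^ n * V b ^ n"
    have "L b ^ p * (P b ^ n * M b b ^ (n - 1)) * V b ^ n = fps_X ^ (n - 1) * S"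
      by (simp add: S_def M_def mult_ac)
    then have tS: "t b = fps_nth S 0" by (simp add: t_def fps_X_power_mult_nth)
    have "fps_const c ^ n * M b a ^ n * S = L b ^ p * ((fps_const c * (P b * M b a)) * V b) ^ n"
      by (simp add: S_def power_mult_distrib mult_ac)
    also have "\<dots> = L b ^ p" unfolding g by simp
    finally have "fps_nth (fps_const c ^ n * M b a ^ n * S) 0 = fps_nth (L b ^ p) 0" by simp
    then have "c ^ n * (- s) ^ n * t b = r b ^ p"
      by (simp add: tS fps_power_zeroth M_def L_def s_def)
    then show ?thesis using s by (simp add: field_simps)
  qed
  have "(\<Sum>j\<in>J. w j * t j) = w a * t a + w b * t b"
  proof -
    have "(\<Sum>j\<in>J. w j * t j) = (\<Sum>j\<in>{a, b}. w j * t j)"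
      by (rule sum.mono_neutral_right) (use J t0 in auto)
    then show ?thesis using J(4) by simp
  qed
  then have sum0: "w a * (c ^ n * t a) + w b * (c ^ n * t b) = 0"
  proof -
    have "w a * (c ^ n * t a) + w b * (c ^ n * t b) = c ^ n * (w a * t a + w b * t b)"
      by (simp add: algebra_simps)
    with \<open>(\<Sum>j\<in>J. w j * t j) = w a * t a + w b * t b\<close> rel' show ?thesis by simp
  qed
  have sign: "(-1) ^ (n - 1) / s ^ n = - (1 / (- s) ^ n)"
    using pn s by (cases n) (simp_all add: power_minus[of s] field_simps)
  have "w a * (r b ^ p * - (1 / (- s) ^ n)) + w b * (r b ^ p / (- s) ^ n) = 0"
    using sum0 unfolding ta tb sign .
  moreover have "u * (P * - (1 / z)) + v * (P / z) = (v - u) * (P / z)" for u v P z :: complex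
    by (simp add: algebra_simps diff_divide_distrib)
  ultimately have "(w b - w a) * (r b ^ p / (- s) ^ n) = 0" by (simp only:)
  then show ?thesis using s rb by simp
qed

lemma poly_relation_of_powers:
  fixes r w :: "nat \<Rightarrow> complex"
  assumes nz: "\<And>j. j \<in> J \<Longrightarrow> r j \<noteq> 0"
    and rel: "\<And>i. i \<le> degree Q \<Longrightarrow> (\<Sum>j\<in>J. w j * fps_nth (taylor_powi (r j) (int (p + i)) * H j) m) = 0"
  shows "(\<Sum>j\<in>J. w j * fps_nth (taylor_shift (r j) (monom 1 p * Q) * H j) m) = 0"
proof -
  have "taylor_shift z (monom 1 p * Q) = (\<Sum>i\<le>degree Q. fps_const (coeff Q i) * taylor_powi z (int (p + i)))"
    if "z \<noteq> 0" for z
  proof -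
    have "monom 1 p * Q = (\<Sum>i\<le>degree Q. [:coeff Q i:] * monom 1 (p + i))"
    proof -
      have "monom 1 p * Q = monom 1 p * (\<Sum>i\<le>degree Q. monom (coeff Q i) i)"
        by (simp only: poly_as_sum_of_monoms)
      then show ?thesis by (simp add: sum_distrib_left mult_monom smult_monom)
    qed
    then show ?thesis
      by (simp only: taylor_shift_sum taylor_shift_mult taylor_shift_const taylor_powi_of_nat[OF that])
  qed
  then have "(\<Sum>j\<in>J. w j * fps_nth (taylor_shift (r j) (monom 1 p * Q) * H j) m) =
      (\<Sum>j\<in>J. \<Sum>i\<le>degree Q. coeff Q i * (w j * fps_nth (taylor_powi (r j) (int (p + i)) * H j) m))"
    using nz by (intro sum.cong refl)
      (simp add: sum_distrib_right fps_sum_nth sum_distrib_left mult.assoc mult.left_commute)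
  also have "\<dots> = (\<Sum>i\<le>degree Q. coeff Q i * (\<Sum>j\<in>J. w j * fps_nth (taylor_powi (r j) (int (p + i)) * H j) m))"
    by (subst sum.swap) (simp add: sum_distrib_left)
  also have "\<dots> = 0" using rel by simp
  finally show ?thesis .
qed

section \<open>Linear relations between the branches\<close>

lemma psi_relation_closed:
  assumes rb: "\<And>j. j \<in> J \<Longrightarrow> root_branch e d U (\<rho> j) (l j) (R j)"
    and U: "open U"
    and rel: "\<And>x. x \<in> U \<Longrightarrow> (\<Sum>j\<in>J. c j * psi_family e d (\<rho> j) (l j) \<alpha> x) = 0"
    and \<gamma>: "\<gamma> \<in> I_A e" and x: "x \<in> U"
  shows "(\<Sum>j\<in>J. c j * psi_family e d (\<rho> j) (l j) (\<alpha> - \<gamma>) x) = 0"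
proof -
  have step: "\<forall>x\<in>U. (\<Sum>j\<in>J. c j * psi_family e d (\<rho> j) (l j) (a - 1, b - int (e i)) x) = 0"
    if "\<forall>x\<in>U. (\<Sum>j\<in>J. c j * psi_family e d (\<rho> j) (l j) (a, b) x) = 0" for a b i
  proof
    fix x assume x: "x \<in> U"
    have "has_partials (\<lambda>y. \<Sum>j\<in>J. c j * psi_family e d (\<rho> j) (l j) (a, b) y)
       (\<lambda>i. \<Sum>j\<in>J. c j * psi_family e d (\<rho> j) (l j) (a - 1, b - int (e i)) x) x"
      by (intro has_partials_sum has_partials_cmult root_branch.has_partials_psi_family[OF rb] x)
    then have "has_partials (\<lambda>y. 0)
       (\<lambda>i. \<Sum>j\<in>J. c j * psi_family e d (\<rho> j) (l j) (a - 1, b - int (e i)) x) x"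
      by (rule has_partials_transform[OF _ U x]) (use that in auto)
    from has_partials_unique[OF this has_partials_const]
    show "(\<Sum>j\<in>J. c j * psi_family e d (\<rho> j) (l j) (a - 1, b - int (e i)) x) = 0"
      by (rule fun_cong)
  qed
  have "\<forall>x\<in>U. (\<Sum>j\<in>J. c j * psi_family e d (\<rho> j) (l j) (\<alpha> - A_nmult e u) x) = 0" for u
  proof (induction "\<Sum>i\<in>UNIV. u i" arbitrary: u)
    case 0
    then have "A_nmult e u = 0" by (simp add: A_mult_def zero_prod_def)
    then show ?case using rel by simp
  next
    case (Suc n)
    obtain i where i: "u i > 0"
    proof (rule ccontr)
      assume "\<not> thesis"
      then have "u i = 0" for i using that by blast
      then show False using Suc.hyps(2) by simp
    qed
    define w where "w = u(i := u i - 1)"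
    have u: "u = bump i w" using i by (auto simp: w_def bump_def)
    have "(\<Sum>j\<in>UNIV. u j) = Suc (\<Sum>j\<in>UNIV. w j)"
      unfolding u by (subst (1 2) sum.remove[of UNIV i]) (auto simp: bump_def intro!: sum.cong)
    then have "n = (\<Sum>j\<in>UNIV. w j)" using Suc.hyps(2) by simp
    from Suc.hyps(1)[OF this]
    have IH: "\<forall>x\<in>U. (\<Sum>j\<in>J. c j * psi_family e d (\<rho> j) (l j) (\<alpha> - A_nmult e w) x) = 0" .
    obtain a b where ab: "\<alpha> - A_nmult e w = (a, b)" by (cases "\<alpha> - A_nmult e w")
    have "\<alpha> - A_nmult e u = (a, b) - (1, int (e i))"
      unfolding u A_nmult_bump ab[symmetric] by (simp add: algebra_simps)
    then have "\<alpha> - A_nmult e u = (a - 1, b - int (e i))" by simp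
    then show ?case using step[OF IH[unfolded ab], of i] by simp
  qed
  then show ?thesis using \<gamma> x unfolding I_A_def by blast
qed

text \<open>
  By differentiation the relation holds at all exponents \<open>\<alpha> - \<gamma>\<close> with \<open>\<gamma>\<close> in the monoid.  Those with
  first coordinate \<open>- n\<close>, for one large \<open>n\<close>, supply enough powers of \<open>t\<close> to form the separating
  polynomial of \<open>a\<close> and \<open>b\<close> times \<open>t^p\<close>.
\<close>

lemma psi_relation_weights_equal:
  fixes e :: "'n::finite \<Rightarrow> nat"
  assumes rb: "\<And>j. j \<in> {1..d} \<Longrightarrow> root_branch e d U (\<rho> j) (l j) (R j)"
    and U: "open U" and x: "x \<in> U"
    and gcd: "Gcd (range e) = 1" and i0: "e i0 = 0" and i1: "e i1 = d"
    and le: "\<And>i. e i \<le> d"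
    and c: "c \<noteq> 0" and inj: "inj_on (\<lambda>j. \<rho> j x) {1..d}"
    and f: "f_poly e x = Polynomial.smult c (\<Prod>k\<in>{1..d}. [:- \<rho> k x, 1:])"
    and rel: "\<And>x. x \<in> U \<Longrightarrow> (\<Sum>j\<in>{1..d}. w j * psi_family e d (\<rho> j) (l j) \<alpha> x) = 0"
    and ab: "a \<in> {1..d}" "b \<in> {1..d}"
  shows "w a = w b"
proof (cases "a = b")
  case False
  obtain \<alpha>1 \<alpha>2 where \<alpha>: "\<alpha> = (\<alpha>1, \<alpha>2)" by (cases \<alpha>)
  define N where "N = int (d * CARD('n))"
  \<comment> \<open>The exponent \<open>p\<close> puts even the lowest power of \<open>t\<close> above the lower boundary of the cone interior.\<close>
  define p where "p = nat (int d * N - \<alpha>2 - 1)"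
  \<comment> \<open>For this \<open>n\<close> the highest power, \<open>p + d n - n - 1\<close>, still lies below the upper boundary.\<close>
  define n where "n = nat (int p + \<bar>\<alpha>1\<bar> + \<bar>\<alpha>2 - int d * \<alpha>1 + int d * N\<bar> + 1)"
  have d: "d > 0" using ab by simp
  have n: "int n = int p + \<bar>\<alpha>1\<bar> + \<bar>\<alpha>2 - int d * \<alpha>1 + int d * N\<bar> + 1" by (simp add: n_def)
  have pn: "p < n" and n0: "n > 0" using n by linarith+
  define r where "r = (\<lambda>j. \<rho> j x)"
  define V where "V = (\<lambda>j. inverse (fps_shift 1 (taylor_shift (r j) (f_poly e x))))"
  let ?Q = "separating_poly r {1..d} a b n"
  have "(\<Sum>j\<in>{1..d}. w j * fps_nth (taylor_shift (r j) (monom 1 p * ?Q) * V j ^ n) (n - 1)) = 0"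
  proof (rule poly_relation_of_powers)
    fix j assume "j \<in> {1..d}"
    then show "r j \<noteq> 0" using root_branch.root_nonzero[OF rb x] by (simp add: r_def)
  next
    fix i assume i: "i \<le> degree ?Q"
    have "degree ?Q + n + 1 = d * n"
      using degree_separating_poly[of "{1..d}" a b n r] ab False n0 by simp
    then have i': "int i + int n + 1 \<le> int d * int n"
      using i by (metis add_le_mono1 of_nat_1 of_nat_add of_nat_le_iff of_nat_mult)
    define m where "m = int n + \<alpha>1"
    \<comment> \<open>At the exponent \<open>(- n, \<alpha>2 - q)\<close> the residue has the numerator \<open>t^(q - \<alpha>2 - 1) = t^(p + i)\<close>.\<close>
    define q where "q = int (p + i) + \<alpha>2 + 1"
    have q1: "int d * N \<le> q" unfolding q_def p_def by linarith
    have q2: "q \<le> int d * (m - N)"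
    proof -
      have "int d * (m - N) = int d * int n + int d * \<alpha>1 - int d * N"
        by (simp add: m_def algebra_simps)
      then show ?thesis using i' n unfolding q_def by linarith
    qed
    have "(m, q) \<in> I_A e"
      by (rule I_A_contains_cone_interior[where e = e, OF gcd i0 i1 d le])
         (use q1 q2 in \<open>simp_all add: N_def\<close>)
    from psi_relation_closed[OF rb U rel this x]
    have "(\<Sum>j\<in>{1..d}. w j * psi_family e d (\<rho> j) (l j) (- int n, \<alpha>2 - q) x) = 0"
      by (simp add: \<alpha> m_def)
    moreover have "psi_family e d (\<rho> j) (l j) (- int n, \<alpha>2 - q) x =
        (-1) ^ n * fact (n - 1) * fps_nth (taylor_powi (r j) (int (p + i)) * V j ^ n) (n - 1)" for j
    proof -
      have "- (\<alpha>2 - q) - 1 = int (p + i)" by (simp add: q_def)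
      then show ?thesis using n0
        by (simp add: psi_family_def psi_neg_def root_cofactor_def r_def V_def)
    qed
    ultimately have "(-1) ^ n * fact (n - 1) *
        (\<Sum>j\<in>{1..d}. w j * fps_nth (taylor_powi (r j) (int (p + i)) * V j ^ n) (n - 1)) = 0"
      by (simp add: sum_distrib_left mult_ac)
    then show "(\<Sum>j\<in>{1..d}. w j * fps_nth (taylor_powi (r j) (int (p + i)) * V j ^ n) (n - 1)) = 0"
      by simp
  qed
  then show ?thesis
    using root_branch.root_nonzero[OF rb x] ab inj f
    unfolding V_def
    by (intro weights_equal_of_residue_relation[OF _ ab False _ _ c _ pn, where r = r and f = "f_poly e x"])
       (auto simp: r_def)
qed simp

lemma sum_fun_scale_apply: "(\<Sum>j\<in>A. fun_scale (c j) (F j)) x = (\<Sum>j\<in>A. c j * F j x)"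
  by (induction A rule: infinite_finite_induct) (auto simp: fun_scale_def)

text \<open>
  A relation among all but the last function extends by the coefficient 0, so its coefficients all
  vanish; the remaining \<open>d - 1\<close> functions are distinct and independent.
\<close>

lemma dim_ge_of_constant_relations:
  fixes F :: "nat \<Rightarrow> 'a \<Rightarrow> complex"
  assumes const: "\<And>c a b. (\<Sum>j\<in>{1..d}. fun_scale (c j) (F j)) = 0 \<Longrightarrow>
    a \<in> {1..d} \<Longrightarrow> b \<in> {1..d} \<Longrightarrow> c a = c b"
  shows "d - 1 \<le> cfun.dim (cfun.span (F ` {1..d}))"
proof -
  let ?B = "F ` {1..<d}"
  have rel0: "c j = 0" if sum: "(\<Sum>j\<in>{1..<d}. fun_scale (c j) (F j)) = 0" and j: "j \<in> {1..<d}" for c j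
  proof -
    define c' where "c' = (\<lambda>j. if j < d then c j else 0)"
    have d: "{1..d} = insert d {1..<d}" using j by auto
    have "(\<Sum>j\<in>{1..d}. fun_scale (c' j) (F j)) = (\<Sum>j\<in>{1..<d}. fun_scale (c j) (F j))"
      unfolding d by (simp add: c'_def fun_scale_def fun_eq_iff)
    from const[OF this[unfolded sum], of j d] show ?thesis using j by (auto simp: c'_def)
  qed
  have inj: "inj_on F {1..<d}"
  proof (rule inj_onI, rule ccontr)
    fix a b assume ab: "a \<in> {1..<d}" "b \<in> {1..<d}" "F a = F b" "a \<noteq> b"
    have "(\<Sum>j\<in>{1..<d}. fun_scale ((if j = a then 1 else 0) + (if j = b then -1 else 0)) (F j)) = 0"
    proof
      fix x
      have "(\<Sum>j\<in>{1..<d}. ((if j = a then 1 else 0) + (if j = b then -1 else 0)) * F j x) =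
          (\<Sum>j\<in>{1..<d}. (if j = a then F j x else 0) + (if j = b then - F j x else 0))"
        by (intro sum.cong) auto
      also have "\<dots> = 0" using ab by (simp add: sum.distrib)
      finally show "(\<Sum>j\<in>{1..<d}. fun_scale ((if j = a then 1 else 0) + (if j = b then -1 else 0)) (F j)) x = 0 x"
        by (simp add: sum_fun_scale_apply)
    qed
    from rel0[OF this ab(1)] ab(4) show False by simp
  qed
  have indep: "cfun.independent ?B"
  proof
    assume "cfun.dependent ?B"
    then obtain u v where v: "v \<in> ?B" "u v \<noteq> 0" and 0: "(\<Sum>v\<in>?B. fun_scale (u v) v) = 0"
      by (subst (asm) cfun.dependent_finite) auto
    from 0 have "(\<Sum>j\<in>{1..<d}. fun_scale (u (F j)) (F j)) = 0"
      unfolding sum.reindex[OF inj] o_def .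
    from rel0[OF this] v show False by auto
  qed
  obtain B where B: "B \<subseteq> cfun.span (F ` {1..d})" "cfun.independent B"
      "cfun.span (F ` {1..d}) \<subseteq> cfun.span B" "card B = cfun.dim (cfun.span (F ` {1..d}))"
    using cfun.basis_exists by blast
  have "finite B" using cfun.independent_span_bound[OF _ B(2,1)] by simp
  moreover have "?B \<subseteq> cfun.span B"
  proof -
    have "?B \<subseteq> F ` {1..d}" by auto
    then show ?thesis using cfun.span_superset[of "F ` {1..d}"] B(3) by blast
  qed
  ultimately have "card ?B \<le> card B" using cfun.independent_span_bound indep by blast
  then show ?thesis unfolding B(4) card_image[OF inj] by simp
qed

lemma f_poly_factorization:
  fixes e :: "'n::finite \<Rightarrow> nat"
  assumes inj: "inj e" and le: "\<And>i. e i \<le> d" and i1: "e i1 = d" and nz: "x $ i1 \<noteq> 0"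
    and bij: "bij_betw r {1..d} {z. poly (f_poly e x) z = 0}"
  shows "f_poly e x = Polynomial.smult (x $ i1) (\<Prod>k\<in>{1..d}. [:- r k, 1:])"
proof -
  have "coeff (f_poly e x) d = (\<Sum>i\<in>UNIV. if i = i1 then x $ i else 0)"
    unfolding f_poly_def coeff_sum using inj i1 by (intro sum.cong) (auto simp: inj_def)
  then have c: "coeff (f_poly e x) d = x $ i1" by simp
  have "degree (f_poly e x) \<le> d"
    unfolding f_poly_def using le by (intro degree_sum_le) (auto intro: order_trans[OF degree_monom_le])
  then have deg: "degree (f_poly e x) = d" using c nz by (intro antisym le_degree) auto
  have "f_poly e x = Polynomial.smult (lead_coeff (f_poly e x)) (\<Prod>k\<in>{1..d}. [:- r k, 1:])"
  proof (rule poly_eq_prod_roots)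
    show "inj_on r {1..d}" using bij by (rule bij_betw_imp_inj_on)
    show "poly (f_poly e x) (r k) = 0" if "k \<in> {1..d}" for k
      using bij_betwE[OF bij] that by blast
  qed (simp_all add: deg)
  then show ?thesis by (simp add: deg c)
qed

text \<open>
  The gradient of the logarithm comes from differentiating \<open>exp (l x) = \<rho> x\<close>.
\<close>

lemma root_branch_of_holomorphic_root:
  fixes e :: "'n::finite \<Rightarrow> nat"
  assumes U: "open U" and le: "\<And>i. e i \<le> d"
    and hol: "mholomorphic_on \<rho> U" "mholomorphic_on l U"
    and exp: "\<And>x. x \<in> U \<Longrightarrow> exp (l x) = \<rho> x"
    and root: "\<And>x. x \<in> U \<Longrightarrow> poly (f_poly e x) (\<rho> x) = 0"
    and simple: "\<And>x. x \<in> U \<Longrightarrow> poly (pderiv (f_poly e x)) (\<rho> x) \<noteq> 0"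
  shows "\<exists>R. root_branch e d U \<rho> l R"
proof -
  obtain R where R: "\<And>x. x \<in> U \<Longrightarrow> has_partials \<rho> (R x) x"
    using mholomorphic_imp_has_partials[OF hol(1)] by metis
  have nz: "\<rho> x \<noteq> 0" if "x \<in> U" for x using exp[OF that] by (metis exp_not_eq_zero)
  have "has_partials l (\<lambda>i. R x i / \<rho> x) x" if x: "x \<in> U" for x
  proof -
    obtain L where L: "has_partials l L x"
      using mholomorphic_imp_has_partials[OF hol(2) x] by blast
    have "has_partials (\<lambda>y. exp (l y)) (\<lambda>i. exp (l x) * L i) x"
      by (rule has_partials_chain[OF L]) (rule DERIV_exp)
    then have "has_partials \<rho> (\<lambda>i. exp (l x) * L i) x"
      by (rule has_partials_transform[OF _ U x]) (rule exp)
    from has_partials_unique[OF this R[OF x]] have "R x = (\<lambda>i. \<rho> x * L i)"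
      using exp[OF x] by simp
    then have "(\<lambda>i. R x i / \<rho> x) = L" using nz[OF x] by simp
    then show ?thesis using L by simp
  qed
  then have "root_branch e d U \<rho> l R"
    using assms R nz by unfold_locales auto
  then show ?thesis by blast
qed

theorem theorem2p4:
  fixes m d :: nat and k :: "nat \<Rightarrow> nat" and e :: "'n::finite \<Rightarrow> nat"
    and U :: "(complex^'n) set"
    and \<rho> logrho :: "nat \<Rightarrow> complex^'n \<Rightarrow> complex"
    and \<alpha> :: "int \<times> int"
  defines "\<psi> \<equiv> (\<lambda>j. psi e d (\<rho> j) (logrho j) \<alpha>)"
  assumes "m \<ge> 1"
    and "0 < k 1" and "strict_mono_on {1..m} k" and "k m < d"
    and "Gcd (k ` {1..m} \<union> {d}) = 1"
    and "bij_betw e UNIV (Lambda_set m k d)"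
    and "open U" and "U \<noteq> {}" and "simply_connected U" and "U \<inter> Sigma_set e d = {}"
    and "\<And>j. j \<in> {1..d} \<Longrightarrow> mholomorphic_on (\<rho> j) U"
    and "\<And>x. x \<in> U \<Longrightarrow> bij_betw (\<lambda>j. \<rho> j x) {1..d} {z. poly (f_poly e x) z = 0}"
    and "\<And>j. j \<in> {1..d} \<Longrightarrow> mholomorphic_on (logrho j) U"
    and "\<And>j x. j \<in> {1..d} \<Longrightarrow> x \<in> U \<Longrightarrow> exp (logrho j x) = \<rho> j x"
    and "\<alpha> \<notin> I_A e"
  shows "(\<forall>j\<in>{1..d}. A_hypergeometric e \<alpha> U (\<psi> j)) \<and>
    cfun.dim (cfun.span ((\<lambda>j. on_set U (\<psi> j)) ` {1..d})) \<ge> d - 1 \<and>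
    (dependent_family {1..d} (\<lambda>j. on_set U (\<psi> j)) \<longleftrightarrow> (\<forall>x\<in>U. (\<Sum>j\<in>{1..d}. \<psi> j x) = 0))"
proof -
  note mono = assms(4) and kd = assms(5) and gcd = assms(6) and bij = assms(7)
    and open_U = assms(8) and Sigma = assms(11) and hol = assms(12) and roots = assms(13)
    and log_hol = assms(14) and exp = assms(15) and notin = assms(16)
  obtain x0 where x0: "x0 \<in> U" using assms(9) by blast
  have inj: "inj e" and range: "range e = Lambda_set m k d"
    using bij by (auto simp: bij_betw_def)
  have le: "e i \<le> d" for i
  proof -
    have "e i \<in> Lambda_set m k d" using range by blast
    moreover have "k j \<le> d" if "j \<in> {1..m}" for j
      using strict_mono_onD[OF mono that, of m] that kd by (cases "j = m") auto
    ultimately show ?thesis by (auto simp: Lambda_set_def)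
  qed
  have "0 \<in> range e" "d \<in> range e" unfolding range by (auto simp: Lambda_set_def)
  then obtain i0 i1 where i0: "e i0 = 0" and i1: "e i1 = d" by (metis imageE)
  have gcd': "Gcd (range e) = 1"
  proof -
    have "range e = insert 0 (k ` {1..m} \<union> {d})" unfolding range by (auto simp: Lambda_set_def)
    then show ?thesis using gcd by simp
  qed
  have lead: "x $ i1 \<noteq> 0" if "x \<in> U" for x
    using Sigma that i1 by (auto simp: Sigma_set_def)
  have factored: "f_poly e x = Polynomial.smult (x $ i1) (\<Prod>k\<in>{1..d}. [:- \<rho> k x, 1:])" if "x \<in> U" for x
    by (rule f_poly_factorization[OF inj le i1 lead[OF that] roots[OF that]])
  have root: "poly (f_poly e x) (\<rho> j x) = 0" if "j \<in> {1..d}" "x \<in> U" for j x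
    using bij_betw_apply[OF roots[OF that(2)] that(1)] by simp
  have simple: "poly (pderiv (f_poly e x)) (\<rho> j x) \<noteq> 0" if "j \<in> {1..d}" "x \<in> U" for j x
  proof -
    have "\<rho> j x \<noteq> \<rho> k x" if k: "k \<in> {1..d}" "k \<noteq> j" for k
    proof
      assume "\<rho> j x = \<rho> k x"
      with bij_betw_imp_inj_on[OF roots[OF \<open>x \<in> U\<close>]] have "j = k"
        using \<open>j \<in> {1..d}\<close> k(1) by (rule inj_onD)
      with k(2) show False by simp
    qed
    moreover have "poly (pderiv (f_poly e x)) (\<rho> j x) =
        x $ i1 * (\<Prod>k\<in>{1..d} - {j}. \<rho> j x - \<rho> k x)"
      unfolding root_cofactor_nth_0[symmetric] root_cofactor_def
      using root_cofactor_prod[OF factored[OF that(2)] _ that(1)] by (simp add: fps_nth_0_prod)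
    ultimately show ?thesis using lead[OF that(2)] by auto
  qed
  have "\<exists>R. root_branch e d U (\<rho> j) (logrho j) R" if "j \<in> {1..d}" for j
    by (rule root_branch_of_holomorphic_root[OF open_U le hol[OF that] log_hol[OF that]
          exp[OF that] root[OF that] simple[OF that]])
  then obtain R where rb: "\<And>j. j \<in> {1..d} \<Longrightarrow> root_branch e d U (\<rho> j) (logrho j) (R j)"
    by metis
  have fam: "\<psi> j x = psi_family e d (\<rho> j) (logrho j) \<alpha> x" if "j \<in> {1..d}" "x \<in> U" for j x
    using root_branch.psi_eq_family[OF rb[OF that(1)] inj that(2)] by (simp add: \<psi>_def)
  let ?F = "\<lambda>j. on_set U (\<psi> j)"
  have rel_iff: "(\<Sum>j\<in>{1..d}. fun_scale (c j) (?F j)) = 0 \<longleftrightarrow>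
      (\<forall>x\<in>U. (\<Sum>j\<in>{1..d}. c j * \<psi> j x) = 0)" for c
  proof -
    have "(\<Sum>j\<in>{1..d}. fun_scale (c j) (?F j)) =
        (\<lambda>x. if x \<in> U then \<Sum>j\<in>{1..d}. c j * \<psi> j x else 0)"
      by (rule ext) (simp add: sum_fun_scale_apply on_set_def)
    then show ?thesis by (auto simp: fun_eq_iff)
  qed
  have const: "c a = c b"
    if rel: "(\<Sum>j\<in>{1..d}. fun_scale (c j) (?F j)) = 0" and "a \<in> {1..d}" "b \<in> {1..d}" for c a b
  proof (rule psi_relation_weights_equal[OF rb open_U x0 gcd' i0 i1 le lead[OF x0] _ factored[OF x0] _ that(2,3)])
    show "inj_on (\<lambda>j. \<rho> j x0) {1..d}" using roots[OF x0] by (rule bij_betw_imp_inj_on)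
    show "(\<Sum>j\<in>{1..d}. c j * psi_family e d (\<rho> j) (logrho j) \<alpha> x) = 0" if "x \<in> U" for x
      using rel[unfolded rel_iff] that fam by simp
  qed
  have "A_hypergeometric e \<alpha> U (\<psi> j)" if "j \<in> {1..d}" for j
    unfolding \<psi>_def by (rule root_branch.A_hypergeometric_psi[OF rb[OF that] inj notin])
  moreover have "cfun.dim (cfun.span (?F ` {1..d})) \<ge> d - 1"
    by (rule dim_ge_of_constant_relations) (rule const)
  moreover have "dependent_family {1..d} ?F \<longleftrightarrow> (\<forall>x\<in>U. (\<Sum>j\<in>{1..d}. \<psi> j x) = 0)"
  proof
    assume "dependent_family {1..d} ?F"
    then obtain c a where a: "a \<in> {1..d}" "c a \<noteq> 0" and rel: "(\<Sum>j\<in>{1..d}. fun_scale (c j) (?F j)) = 0"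
      unfolding dependent_family_def by blast
    show "\<forall>x\<in>U. (\<Sum>j\<in>{1..d}. \<psi> j x) = 0"
    proof
      fix x assume "x \<in> U"
      then have "0 = (\<Sum>j\<in>{1..d}. c j * \<psi> j x)" using rel[unfolded rel_iff] by simp
      also have "\<dots> = (\<Sum>j\<in>{1..d}. c a * \<psi> j x)"
        using const[OF rel _ a(1)] by (intro sum.cong) auto
      finally have "c a * (\<Sum>j\<in>{1..d}. \<psi> j x) = 0" by (simp add: sum_distrib_left)
      then show "(\<Sum>j\<in>{1..d}. \<psi> j x) = 0" using a(2) by simp
    qed
  next
    assume "\<forall>x\<in>U. (\<Sum>j\<in>{1..d}. \<psi> j x) = 0"
    then have "(\<Sum>j\<in>{1..d}. fun_scale 1 (?F j)) = 0" using rel_iff[of "\<lambda>j. 1"] by simp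
    moreover have "1 \<in> {1..d}" using kd by simp
    ultimately show "dependent_family {1..d} ?F"
      unfolding dependent_family_def by (intro exI[of _ "\<lambda>j. 1"]) auto
  qed
  ultimately show ?thesis by blast
qed

end
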